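(* Let $p$ and $q$ be relatively prime integers with $p>q>0$, and let $1<r<p$ and $s\in\mathbb{Z}$. With the nonnegative integers $m$, $\overline{k'}$, $Q'$, and $\overline{k_i}$, $Q_i$ ($i=1,\dots,r-1$) determined by $(p,q,r)$ as in the context, the Alexander polynomial of the twisted torus knot $T(p,q;r,s)$ is given, up to multiplication by $\pm t^{\pm n}$, by \[ \Delta_{T(p,q;r,s)}(t)=\frac{1-t}{(1-t^p)(1-t^q)(1-t^{r})}\left(\tilde{X}(t)Y(t)-X(t)\tilde{Y}(t)\right),\] where \[X(t)=1-(1-t^{rs})\sum_{i=1}^{r-1}t^{\overline{k_i}p+(i-1)rs}-t^{pq+(r-1)rs},\] \[\tilde{X}(t)=\begin{cases}1-t^{\overline{k'}p},&\text{if } m=0,\\ 1-(1-t^{rs})\displaystyle\sum_{i=1}^{m}t^{\overline{k_i}p+(i-1)rs}-t^{\overline{k'}p+mrs},&\text{otherwise,}\end{cases}\] \[Y(t)=1-(1-t^{rs})\sum_{i=1}^{r-1}t^{Q_iq+(i-1)rs}-t^{pq+(r-1)rs},\] \[\tilde{Y}(t)=\begin{cases}1-t^{Q'q},&\text{if } m=0,\\ 1-(1-t^{rs})\displaystyle\sum_{i=1}^{m}t^{Q_iq+(i-1)rs}-t^{Q'q+mrs},&\text{otherwise.}\end{cases}\]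
   Context: Twisted torus knot: for $p>q>0$ with $\gcd(p,q)=1$, $1<r<p$, $s\in\mathbb{Z}$, the twisted torus knot $T(p,q;r,s)\subset S^3$ is obtained from the torus knot $T(p,q)$ by applying $s$ full twists to $r$ adjacent strands; equivalently, it is the closure of the $p$-strand braid $(\sigma_1\sigma_2\cdots\sigma_{p-1})^q(\sigma_1\cdots\sigma_{r-1})^{rs}$. Integers attached to $(p,q,r)$: $[x]$ denotes the residue of $x$ modulo $p$ with $0\le [x]<p$, and $q^{-1}$ is the multiplicative inverse of $q$ modulo $p$. - $Q:=\{[nq^{-1}] : n=0,\dots,r-1\}=\{Q_0<Q_1<\dots<Q_{r-1}\}$ (elements listed in increasing order). - $R:=\{[-nq^{-1}] : n=1,\dots,q\}$. - $k_i:=|\{l\in R : Q_{i-1}\le l<Q_i\}|$ for $i=1,\dots,r-1$. - $Q':=[rq^{-1}]$, which is not in $Q$; $m\in\{0,\dots,r-1\}$ is the index such that $Q_0<\dots<Q_m<Q'<Q_{m+1}<\dots<Q_{r-1}$ (so $m=r-1$ if $Q'>Q_{r-1}$). - $k':=|\{l\in R : Q_m\le l<Q'\}|$. - $\overline{k_i}:=k_1+\dots+k_i$ for $i=1,\dots,r-1$, and $\overline{k'}:=k_1+\dots+k_m+k'$. *)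

theory Defs
  imports
    "HOL-Library.Poly_Mapping"
    "HOL-Number_Theory.Modular_Inverse"
    "Jordan_Normal_Form.Determinant"
    "Jordan_Normal_Form.DL_Submatrix"
begin

section \<open>The Laurent polynomial ring\<close>

text \<open>
  Finitely supported functions from the integers to the integers, with convolution as product,
  form the group ring of the infinite cyclic group.
\<close>

type_synonym laurent = "int \<Rightarrow>\<^sub>0 int"

definition tpow :: "int \<Rightarrow> laurent" where
  "tpow k = Poly_Mapping.single k 1"

section \<open>The Alexander polynomial of a group presentation\<close>

text \<open>
  In a word, \<open>(g, True)\<close> stands for the generator \<open>x\<^sub>g\<close> and \<open>(g, False)\<close> for its inverse.
\<close>

type_synonym fword = "(nat \<times> bool) list"

text \<open>
  The Fox derivative with respect to \<open>x\<^sub>j\<close>, mapped to the Laurent polynomials by sending every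
  generator to \<open>t\<close>. The equations are the product rule
  \<open>D (u v) = D u + u (D v)\<close> together with \<open>D (x\<^sub>g) = \<delta>\<close> and \<open>D (x\<^sub>g\<inverse>) = - x\<^sub>g\<inverse> \<delta>\<close>, where
  \<open>\<delta>\<close> is 1 if \<open>g = j\<close> and 0 otherwise.
\<close>

fun fox :: "nat \<Rightarrow> fword \<Rightarrow> laurent" where
  "fox j [] = 0"
| "fox j ((g, True) # w) = (if g = j then 1 else 0) + tpow 1 * fox j w"
| "fox j ((g, False) # w) = - (if g = j then tpow (-1) else 0) + tpow (-1) * fox j w"

definition alexander_matrix :: "nat \<Rightarrow> fword list \<Rightarrow> laurent mat" where
  "alexander_matrix n rels = mat (length rels) n (\<lambda>(i, j). fox j (rels ! i))"

text \<open>Generators of the first elementary ideal of a matrix with \<open>n\<close> columns: its minors of size \<open>n - 1\<close>.\<close>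

definition first_minors :: "laurent mat \<Rightarrow> laurent set" where
  "first_minors A =
     {det (submatrix A I J) | I J.
        I \<subseteq> {..<dim_row A} \<and> J \<subseteq> {..<dim_col A} \<and>
        card I = dim_col A - 1 \<and> card J = dim_col A - 1}"

text \<open>
  \<open>D\<close> is an Alexander polynomial of the presentation with generators \<open>x\<^sub>0, \<dots>, x\<^bsub>n-1\<^esub>\<close> and relators
  \<open>rels\<close> if it generates the smallest principal ideal that contains the first elementary ideal of
  the Alexander matrix, that is, if it is a greatest common divisor of the minors.
\<close>

definition is_alexander_polynomial :: "nat \<Rightarrow> fword list \<Rightarrow> laurent \<Rightarrow> bool" where
  "is_alexander_polynomial n rels D \<longleftrightarrow>
     (\<forall>a \<in> first_minors (alexander_matrix n rels). D dvd a) \<and>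
     (\<forall>d. (\<forall>a \<in> first_minors (alexander_matrix n rels). d dvd a) \<longrightarrow> d dvd D)"

section \<open>Closed braids and their knot groups\<close>

text \<open>
  A braid word on the strand positions \<open>1, \<dots>, n\<close>: \<open>(i, True)\<close> stands for \<open>\<sigma>\<^sub>i\<close> and
  \<open>(i, False)\<close> for its inverse, with \<open>1 \<le> i < n\<close>.
\<close>

type_synonym braid_word = "(nat \<times> bool) list"

definition braid_inverse :: "braid_word \<Rightarrow> braid_word" where
  "braid_inverse w = rev (map (\<lambda>(i, b). (i, \<not> b)) w)"

definition braid_power :: "braid_word \<Rightarrow> int \<Rightarrow> braid_word" where
  "braid_power w z =
     (if z \<ge> 0 then concat (replicate (nat z) w)
      else concat (replicate (nat (- z)) (braid_inverse w)))"

text \<open>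
  In the diagram of the closure of a braid word \<open>w\<close> on \<open>n\<close> strands, \<open>edge n k j\<close> is (the number of)
  the meridian generator of the piece of strand at position \<open>j\<close> after the first \<open>k\<close> letters of
  \<open>w\<close>, where \<open>1 \<le> j \<le> n\<close> and \<open>0 \<le> k \<le> length w\<close>.
\<close>

definition edge :: "nat \<Rightarrow> nat \<Rightarrow> nat \<Rightarrow> nat" where
  "edge n k j = k * n + (j - 1)"

text \<open>
  The meridian at position \<open>j\<close> after the letter \<open>c\<close>, in terms of the meridians \<open>x\<^sub>1, \<dots>, x\<^sub>n\<close>
  before it. At \<open>\<sigma>\<^sub>i\<close> the strand moving from \<open>i\<close> to \<open>i + 1\<close> passes over and keeps its meridian
  \<open>x\<^sub>i\<close>, and the other strand leaves the crossing with meridian \<open>x\<^sub>i x\<^bsub>i+1\<^esub> x\<^sub>i\<inverse>\<close>; at the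
  inverse letter the strand moving from \<open>i + 1\<close> to \<open>i\<close> passes over.
\<close>

definition meridian_after :: "nat \<Rightarrow> nat \<Rightarrow> nat \<times> bool \<Rightarrow> nat \<Rightarrow> fword" where
  "meridian_after n k c j =
     (case c of
        (i, True) \<Rightarrow>
          if j = i then [(edge n k i, True), (edge n k (i + 1), True), (edge n k i, False)]
          else if j = i + 1 then [(edge n k i, True)]
          else [(edge n k j, True)]
      | (i, False) \<Rightarrow>
          if j = i then [(edge n k (i + 1), True)]
          else if j = i + 1 then
            [(edge n k (i + 1), False), (edge n k i, True), (edge n k (i + 1), True)]
          else [(edge n k j, True)])"

text \<open>
  The Wirtinger presentation of the closed braid diagram, with arcs subdivided at every letter.
  The relators of the second line close up the braid.
\<close>

definition closure_relators :: "nat \<Rightarrow> braid_word \<Rightarrow> fword list" where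
  "closure_relators n w =
     [(edge n (k + 1) j, False) # meridian_after n k (w ! k) j. k \<leftarrow> [0..<length w], j \<leftarrow> [1..<n + 1]] @
     [[(edge n (length w) j, False), (edge n 0 j, True)]. j \<leftarrow> [1..<n + 1]]"

text \<open>
  All meridians of the oriented closed braid are sent to \<open>t\<close>, as in the definition of \<open>fox\<close>.
\<close>

definition is_closure_alexander_polynomial :: "nat \<Rightarrow> braid_word \<Rightarrow> laurent \<Rightarrow> bool" where
  "is_closure_alexander_polynomial n w D \<longleftrightarrow>
     is_alexander_polynomial ((length w + 1) * n) (closure_relators n w) D"

definition twisted_torus_braid :: "nat \<Rightarrow> nat \<Rightarrow> nat \<Rightarrow> int \<Rightarrow> braid_word" where
  "twisted_torus_braid p q r s =
     braid_power (map (\<lambda>i. (i, True)) [1..<p]) (int q) @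
     braid_power (map (\<lambda>i. (i, True)) [1..<r]) (int r * s)"

section \<open>The integers attached to the parameters\<close>

text \<open>\<open>tt_res p q n\<close> is the residue \<open>[n q\<inverse>]\<close> modulo \<open>p\<close>.\<close>

definition tt_res :: "nat \<Rightarrow> nat \<Rightarrow> int \<Rightarrow> int" where
  "tt_res p q n = (n * modular_inverse (int p) (int q)) mod int p"

definition tt_Qset :: "nat \<Rightarrow> nat \<Rightarrow> nat \<Rightarrow> int set" where
  "tt_Qset p q r = {tt_res p q (int n) | n. n < r}"

definition tt_Q :: "nat \<Rightarrow> nat \<Rightarrow> nat \<Rightarrow> nat \<Rightarrow> int" where
  "tt_Q p q r i = sorted_list_of_set (tt_Qset p q r) ! i"

definition tt_Rset :: "nat \<Rightarrow> nat \<Rightarrow> int set" where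
  "tt_Rset p q = {tt_res p q (- int n) | n. 1 \<le> n \<and> n \<le> q}"

definition tt_k :: "nat \<Rightarrow> nat \<Rightarrow> nat \<Rightarrow> nat \<Rightarrow> nat" where
  "tt_k p q r i = card {l \<in> tt_Rset p q. tt_Q p q r (i - 1) \<le> l \<and> l < tt_Q p q r i}"

definition tt_Q' :: "nat \<Rightarrow> nat \<Rightarrow> nat \<Rightarrow> int" where
  "tt_Q' p q r = tt_res p q (int r)"

definition tt_m :: "nat \<Rightarrow> nat \<Rightarrow> nat \<Rightarrow> nat" where
  "tt_m p q r = (THE i. i < r \<and> tt_Q p q r i < tt_Q' p q r \<and> (i + 1 < r \<longrightarrow> tt_Q' p q r < tt_Q p q r (i + 1)))"

definition tt_k' :: "nat \<Rightarrow> nat \<Rightarrow> nat \<Rightarrow> nat" where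
  "tt_k' p q r = card {l \<in> tt_Rset p q. tt_Q p q r (tt_m p q r) \<le> l \<and> l < tt_Q' p q r}"

definition tt_kbar :: "nat \<Rightarrow> nat \<Rightarrow> nat \<Rightarrow> nat \<Rightarrow> nat" where
  "tt_kbar p q r i = (\<Sum>j = 1..i. tt_k p q r j)"

definition tt_kbar' :: "nat \<Rightarrow> nat \<Rightarrow> nat \<Rightarrow> nat" where
  "tt_kbar' p q r = tt_kbar p q r (tt_m p q r) + tt_k' p q r"

section \<open>The four Laurent polynomials\<close>

definition tt_X :: "nat \<Rightarrow> nat \<Rightarrow> nat \<Rightarrow> int \<Rightarrow> laurent" where
  "tt_X p q r s =
     1 - (1 - tpow (int r * s)) *
           (\<Sum>i = 1..r - 1. tpow (int (tt_kbar p q r i) * int p + (int i - 1) * int r * s))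
       - tpow (int p * int q + (int r - 1) * int r * s)"

definition tt_Xtilde :: "nat \<Rightarrow> nat \<Rightarrow> nat \<Rightarrow> int \<Rightarrow> laurent" where
  "tt_Xtilde p q r s =
     (if tt_m p q r = 0 then 1 - tpow (int (tt_kbar' p q r) * int p)
      else 1 - (1 - tpow (int r * s)) *
                 (\<Sum>i = 1..tt_m p q r. tpow (int (tt_kbar p q r i) * int p + (int i - 1) * int r * s))
             - tpow (int (tt_kbar' p q r) * int p + int (tt_m p q r) * int r * s))"

definition tt_Y :: "nat \<Rightarrow> nat \<Rightarrow> nat \<Rightarrow> int \<Rightarrow> laurent" where
  "tt_Y p q r s =
     1 - (1 - tpow (int r * s)) *
           (\<Sum>i = 1..r - 1. tpow (tt_Q p q r i * int q + (int i - 1) * int r * s))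
       - tpow (int p * int q + (int r - 1) * int r * s)"

definition tt_Ytilde :: "nat \<Rightarrow> nat \<Rightarrow> nat \<Rightarrow> int \<Rightarrow> laurent" where
  "tt_Ytilde p q r s =
     (if tt_m p q r = 0 then 1 - tpow (tt_Q' p q r * int q)
      else 1 - (1 - tpow (int r * s)) *
                 (\<Sum>i = 1..tt_m p q r. tpow (tt_Q p q r i * int q + (int i - 1) * int r * s))
             - tpow (tt_Q' p q r * int q + int (tt_m p q r) * int r * s))"

end

theory Submission
  imports Defs
begin

text \<open>
  The Alexander matrix of a closed braid has the all-ones vector in its right kernel and units in its
  left kernel, so all its maximal minors are associated, and eliminating the meridians level by level
  leaves the reduced Burau matrix: up to units, \<open>(1 - t^n) \<Delta> = (1 - t) det (B - 1)\<close>.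

  Let \<open>y_j\<close> be the Fox coordinate of the product \<open>x_1 ... x_j\<close> of the first \<open>j\<close> meridians of the
  \<open>p\<close> strands, extended by \<open>y_(j+p) = y_p + t^p y_j\<close>. Then \<open>(\<sigma>_1 ... \<sigma>_(p-1))^q\<close> acts by
  \<open>y_j \<mapsto> y_(j+q) - t^j y_q\<close>, and the \<open>s\<close> full twists conjugate the first \<open>r\<close> strands by
  \<open>(x_1 ... x_r)^s\<close>. On \<open>y_p = 0\<close> the numbers \<open>t^(-j) y_j\<close> are periodic modulo \<open>p\<close>. After adjoining
  two unknowns, at the price of the factor \<open>(1 - t^q) (1 - t^r)\<close>, the equations become a first order
  recursion along the orbit \<open>0, q, 2q, \<dots>\<close> modulo \<open>p\<close>, which is perturbed exactly when the orbit
  meets \<open>{0..<r}\<close>, that is, at the times in \<open>Q\<close>. The number of wraps around \<open>p\<close> up to time \<open>l\<close> is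
  the number of elements of \<open>R\<close> below \<open>l\<close>. Solving the recursion leaves two equations in two
  unknowns, closing up the orbit and defining the second unknown at time \<open>Q'\<close>; their coefficients
  are \<open>Y, X\<close> and those with tilde.
\<close>

section \<open>Laurent polynomials\<close>

lemma tpow_0 [simp]: "tpow 0 = 1"
  by (simp add: tpow_def)

lemma tpow_add: "tpow (a + b) = tpow a * tpow b"
  by (simp add: tpow_def mult_single)

lemma tpow_mult: "tpow a * tpow b = tpow (a + b)"
  by (simp add: tpow_add)

lemma tpow_mult_left: "tpow a * (tpow b * c) = tpow (a + b) * c"
  by (simp add: tpow_add mult.assoc)

lemma tpow_mult_mid: "tpow a * (c * tpow b) = tpow (a + b) * c" "tpow a * (c * (tpow b * d)) = tpow (a + b) * (c * d)"
  by (simp_all add: tpow_add mult_ac)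

lemmas tpow_collect = tpow_mult tpow_mult_left tpow_mult_mid

lemma tpow_cancel [simp]: "tpow a * tpow (- a) = 1" "tpow (- a) * tpow a = 1"
  by (simp_all add: tpow_mult)

lemma tpow_nonzero [simp]: "tpow a \<noteq> 0"
  by (metis tpow_cancel(1) mult_zero_left zero_neq_one)

lemma tpow_power: "tpow a ^ n = tpow (int n * a)"
  by (induction n) (simp_all add: tpow_mult algebra_simps)

lemma tpow_eq_1_iff: "tpow a = 1 \<longleftrightarrow> a = 0"
proof
  assume "tpow a = 1"
  then have "Poly_Mapping.lookup (tpow a) a = Poly_Mapping.lookup (1 :: laurent) a"
    by simp
  then show "a = 0"
    by (simp add: tpow_def lookup_one when_def split: if_splits)
qed simp

lemma one_minus_tpow_nonzero: "a \<noteq> 0 \<Longrightarrow> 1 - tpow a \<noteq> 0"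
  using tpow_eq_1_iff by fastforce

section \<open>Units of the Laurent polynomial ring\<close>

definition lunit :: "laurent \<Rightarrow> bool" where
  "lunit u \<longleftrightarrow> (\<exists>e \<in> {1, - 1}. \<exists>n. u = e * tpow n)"

lemma lunit_tpow [simp]: "lunit (tpow n)"
  unfolding lunit_def by force

lemma lunit_1 [simp]: "lunit 1"
  using lunit_tpow[of 0] by simp

lemma lunit_uminus [simp]: "lunit (- u) \<longleftrightarrow> lunit u"
proof -
  have "lunit (- u)" if "lunit u" for u
    using that unfolding lunit_def by auto
  from this[of u] this[of "- u"] show ?thesis
    by auto
qed

lemma lunit_mult: "lunit u \<Longrightarrow> lunit v \<Longrightarrow> lunit (u * v)"
  unfolding lunit_def by (fastforce simp: tpow_mult)

lemma lunit_prod: "(\<And>i. i \<in> I \<Longrightarrow> lunit (f i)) \<Longrightarrow> lunit (prod f I)"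
  by (induction I rule: infinite_finite_induct) (auto intro: lunit_mult)

lemma lunit_inverse: "lunit u \<Longrightarrow> \<exists>v. lunit v \<and> u * v = 1"
proof -
  assume "lunit u"
  then obtain e n where "e \<in> {1, -1}" "u = e * tpow n"
    unfolding lunit_def by blast
  then show ?thesis
    by (intro exI[of _ "e * tpow (- n)"]) (auto simp: tpow_mult)
qed

lemma lunit_nonzero: "lunit u \<Longrightarrow> u \<noteq> 0"
  using lunit_inverse by fastforce

lemma sum_single_keys:
  "(\<Sum>a\<in>Poly_Mapping.keys f. Poly_Mapping.single a (Poly_Mapping.lookup f a)) = f"
  by (rule poly_mapping_eqI) (simp add: lookup_sum lookup_single when_def in_keys_iff)

text \<open>Under the hypothesis at most one pair of terms contributes to this exponent, so the
  convolution collapses to one product. It is meant for the highest and the lowest terms of the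
  factors.\<close>

lemma lookup_mult_extreme:
  fixes f g :: laurent
  assumes "\<And>a b. a \<in> Poly_Mapping.keys f \<Longrightarrow> b \<in> Poly_Mapping.keys g \<Longrightarrow> a + b = k + l \<Longrightarrow> a = k \<and> b = l"
  shows "Poly_Mapping.lookup (f * g) (k + l) = Poly_Mapping.lookup f k * Poly_Mapping.lookup g l"
proof -
  have "Poly_Mapping.lookup (f * g) (k + l) = (\<Sum>a\<in>Poly_Mapping.keys f. \<Sum>b\<in>Poly_Mapping.keys g. Poly_Mapping.lookup f a * Poly_Mapping.lookup g b when a + b = k + l)"
  proof -
    have "f * g = (\<Sum>a\<in>Poly_Mapping.keys f. Poly_Mapping.single a (Poly_Mapping.lookup f a)) * (\<Sum>b\<in>Poly_Mapping.keys g. Poly_Mapping.single b (Poly_Mapping.lookup g b))"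
      by (simp only: sum_single_keys)
    also have "\<dots> = (\<Sum>a\<in>Poly_Mapping.keys f. \<Sum>b\<in>Poly_Mapping.keys g. Poly_Mapping.single (a + b) (Poly_Mapping.lookup f a * Poly_Mapping.lookup g b))"
      by (simp add: sum_product mult_single)
    finally show ?thesis
      by (simp add: lookup_sum lookup_single)
  qed
  also have "\<dots> = (\<Sum>a\<in>Poly_Mapping.keys f. \<Sum>b\<in>Poly_Mapping.keys g. if a = k then (if b = l then Poly_Mapping.lookup f k * Poly_Mapping.lookup g l else 0) else 0)"
    by (intro sum.cong refl) (use assms in \<open>auto simp: when_def\<close>)
  also have "\<dots> = (\<Sum>a\<in>Poly_Mapping.keys f. if a = k then (\<Sum>b\<in>Poly_Mapping.keys g. if b = l then Poly_Mapping.lookup f k * Poly_Mapping.lookup g l else 0) else 0)"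
    by (intro sum.cong refl) auto
  also have "\<dots> = Poly_Mapping.lookup f k * Poly_Mapping.lookup g l"
    by (auto simp: sum.delta in_keys_iff)
  finally show ?thesis .
qed

text \<open>Highest exponents add under multiplication, and so do lowest ones. For a product equal
  to 1 both sums vanish, which forces the highest and lowest exponents of \<open>u\<close> to agree.
  The single coefficient then divides 1.\<close>

lemma dvd_one_imp_lunit:
  assumes "u dvd 1"
  shows "lunit u"
proof -
  from assms obtain v where uv: "1 = u * v"
    by (elim dvdE)
  then have ne: "u \<noteq> 0" "v \<noteq> 0"
    by auto
  then have K: "Poly_Mapping.keys u \<noteq> {}" "Poly_Mapping.keys v \<noteq> {}" "finite (Poly_Mapping.keys u)" "finite (Poly_Mapping.keys v)"
    by auto
  let ?a = "Max (Poly_Mapping.keys u)" and ?b = "Max (Poly_Mapping.keys v)" and ?c = "Min (Poly_Mapping.keys u)" and ?d = "Min (Poly_Mapping.keys v)"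
  have M: "?a \<in> Poly_Mapping.keys u" "?b \<in> Poly_Mapping.keys v" "?c \<in> Poly_Mapping.keys u" "?d \<in> Poly_Mapping.keys v"
    using K by auto
  have le: "i \<le> ?a" "?c \<le> i" if "i \<in> Poly_Mapping.keys u" for i
    using that K by auto
  have le': "i \<le> ?b" "?d \<le> i" if "i \<in> Poly_Mapping.keys v" for i
    using that K by auto
  have "Poly_Mapping.lookup (u * v) (?a + ?b) = Poly_Mapping.lookup u ?a * Poly_Mapping.lookup v ?b"
  proof (rule lookup_mult_extreme)
    fix a b assume "a \<in> Poly_Mapping.keys u" "b \<in> Poly_Mapping.keys v" "a + b = ?a + ?b"
    then show "a = ?a \<and> b = ?b"
      using le(1)[of a] le'(1)[of b] by linarith
  qed
  then have 1: "?a + ?b = 0" "Poly_Mapping.lookup u ?a * Poly_Mapping.lookup v ?b = 1"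
    using M by (auto simp: uv[symmetric] lookup_one in_keys_iff when_def split: if_splits)
  have "Poly_Mapping.lookup (u * v) (?c + ?d) = Poly_Mapping.lookup u ?c * Poly_Mapping.lookup v ?d"
  proof (rule lookup_mult_extreme)
    fix a b assume "a \<in> Poly_Mapping.keys u" "b \<in> Poly_Mapping.keys v" "a + b = ?c + ?d"
    then show "a = ?c \<and> b = ?d"
      using le(2)[of a] le'(2)[of b] by linarith
  qed
  then have 2: "?c + ?d = 0"
    using M by (auto simp: uv[symmetric] lookup_one in_keys_iff when_def split: if_splits)
  have "?c = ?a"
    using 1 2 le(2)[OF M(1)] le'(2)[OF M(2)] by linarith
  then have "Poly_Mapping.keys u = {?a}"
    using le M(1) by (intro equalityI subsetI) (auto intro: antisym)
  then obtain a where a: "Poly_Mapping.keys u = {a}" "?a = a"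
    by metis
  then have u: "u = Poly_Mapping.single a (Poly_Mapping.lookup u a)"
    using sum_single_keys[of u] by simp
  have "Poly_Mapping.lookup u a = 1 \<or> Poly_Mapping.lookup u a = - 1"
    using 1(2) unfolding a(2) by (auto simp: zmult_eq_1_iff)
  then have "u = tpow a \<or> u = - tpow a"
    using u unfolding tpow_def by (metis single_uminus)
  then show ?thesis
    by auto
qed

section \<open>Determinants of functions of two indices\<close>

text \<open>With entries given by a function, reordering rows or columns is composition and passing
  to a block is an index shift, without matrix carriers.\<close>

definition fdet :: "nat \<Rightarrow> (nat \<Rightarrow> nat \<Rightarrow> 'a::comm_ring_1) \<Rightarrow> 'a" where
  "fdet n f = det (mat n n (\<lambda>(i, j). f i j))"

lemma fdet_cong:
  "(\<And>i j. i < n \<Longrightarrow> j < n \<Longrightarrow> f i j = g i j) \<Longrightarrow> fdet n f = fdet n g"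
  unfolding fdet_def by (rule arg_cong[of _ _ det]) auto

lemma fdet_mult: "fdet n (\<lambda>i j. \<Sum>k<n. f i k * g k j) = fdet n f * fdet n g"
proof -
  have "mat n n (\<lambda>(i, j). \<Sum>k<n. f i k * g k j) = mat n n (\<lambda>(i, j). f i j) * mat n n (\<lambda>(i, j). g i j)"
    by (rule eq_matI) (auto simp: scalar_prod_def atLeast0LessThan)
  then show ?thesis
    unfolding fdet_def by (simp add: det_mult[of _ n])
qed

lemma fdet_lower_triangular:
  assumes "\<And>i j. i < j \<Longrightarrow> j < n \<Longrightarrow> f i j = 0"
  shows "fdet n f = (\<Prod>i<n. f i i)"
  unfolding fdet_def
  by (subst det_lower_triangular[of n]) (use assms in \<open>auto simp: prod_list_diag_prod atLeast0LessThan\<close>)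

lemma fdet_upper_triangular:
  assumes "\<And>i j. j < i \<Longrightarrow> i < n \<Longrightarrow> f i j = 0"
  shows "fdet n f = (\<Prod>i<n. f i i)"
  unfolding fdet_def
  by (subst det_upper_triangular[of _ n]) (use assms in \<open>auto simp: prod_list_diag_prod atLeast0LessThan\<close>)

lemma fdet_transpose: "fdet n (\<lambda>i j. f j i) = fdet n f"
proof -
  have "mat n n (\<lambda>(i, j). f j i) = transpose_mat (mat n n (\<lambda>(i, j). f i j))"
    by auto
  then show ?thesis
    unfolding fdet_def by (simp add: det_transpose[of _ n])
qed

lemma fdet_scale:
  "fdet n (\<lambda>i j. a i * f i j * b j) = (\<Prod>i<n. a i) * (\<Prod>j<n. b j) * fdet n f"
proof -
  have diag: "fdet n (\<lambda>i j. if i = j then c i else 0) = (\<Prod>i<n. c i)" for c :: "nat \<Rightarrow> 'a"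
    by (subst fdet_lower_triangular) auto
  have "fdet n (\<lambda>i j. a i * f i j * b j) = fdet n (\<lambda>i j. \<Sum>k<n. (if i = k then a i else 0) * (f k j * b j))"
    by (rule fdet_cong) (simp add: if_distrib[of "\<lambda>x. x * _"] mult.assoc cong: if_cong)
  also have "\<dots> = (\<Prod>i<n. a i) * fdet n (\<lambda>i j. f i j * b j)"
    by (simp only: fdet_mult diag)
  also have "fdet n (\<lambda>i j. f i j * b j) = fdet n (\<lambda>i j. \<Sum>k<n. f i k * (if k = j then b k else 0))"
    by (rule fdet_cong) (simp add: if_distrib[of "\<lambda>x. _ * x"] cong: if_cong)
  also have "\<dots> = fdet n f * (\<Prod>i<n. b i)"
    by (simp only: fdet_mult diag)
  finally show ?thesis
    by (simp add: ac_simps)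
qed

lemma fdet_permute_rows:
  assumes "\<rho> permutes {..<n}"
  shows "\<exists>e \<in> {1, -1}. fdet n (\<lambda>i j. f (\<rho> i) j) = e * fdet n f"
proof -
  have "mat n n (\<lambda>(i, j). f (\<rho> i) j) = mat n n (\<lambda>(i, j). mat n n (\<lambda>(i, j). f i j) $$ (\<rho> i, j))"
    using permutes_in_image[OF assms] by (intro eq_matI) auto
  then have "fdet n (\<lambda>i j. f (\<rho> i) j) = signof \<rho> * fdet n f"
    unfolding fdet_def using assms by (simp add: det_permute_rows atLeast0LessThan)
  then show ?thesis
    by (auto simp: sign_def)
qed

lemma fdet_permute_cols:
  assumes "\<rho> permutes {..<n}"
  shows "\<exists>e \<in> {1, -1}. fdet n (\<lambda>i j. f i (\<rho> j)) = e * fdet n f"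
  using fdet_permute_rows[OF assms, of "\<lambda>i j. f j i"]
  by (simp add: fdet_transpose[of n f] fdet_transpose[of n "\<lambda>i j. f i (\<rho> j)", symmetric])

lemma fdet_four_block:
  fixes f :: "nat \<Rightarrow> nat \<Rightarrow> 'a::idom"
  assumes "\<And>i j. i < n \<Longrightarrow> j < m \<Longrightarrow> f i (n + j) = 0"
  shows "fdet (n + m) f = fdet n f * fdet m (\<lambda>i j. f (n + i) (n + j))"
proof -
  have "mat (n + m) (n + m) (\<lambda>(i, j). f i j) =
    four_block_mat (mat n n (\<lambda>(i, j). f i j)) (0\<^sub>m n m)
      (mat m n (\<lambda>(i, j). f (n + i) j)) (mat m m (\<lambda>(i, j). f (n + i) (n + j)))"
  proof (rule eq_matI, goal_cases)
    case (1 i j)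
    then show ?case
      using assms[of i "j - n"] by auto
  qed auto
  then show ?thesis
    unfolding fdet_def by (simp add: det_four_block_mat_upper_right_zero[of _ n])
qed

lemma fdet_four_block':
  fixes f :: "nat \<Rightarrow> nat \<Rightarrow> 'a::idom"
  assumes "\<And>i j. i < m \<Longrightarrow> j < n \<Longrightarrow> f (n + i) j = 0"
  shows "fdet (n + m) f = fdet n f * fdet m (\<lambda>i j. f (n + i) (n + j))"
  using fdet_four_block[of n m "\<lambda>i j. f j i"] assms
  by (simp add: fdet_transpose[of "n + m" f] fdet_transpose[of n f] fdet_transpose[of m "\<lambda>i j. f (n + i) (n + j)"])

text \<open>The columns of \<open>W\<close> solve the first \<open>n\<close> equations. Multiplying
  on the right by the matrix whose first columns are unit vectors and whose last columns are
  \<open>W\<close> keeps the first \<open>n\<close> columns of \<open>f\<close> and clears the upper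
  right block. The factor on the left accounts for the free coordinates of the solutions.\<close>

lemma fdet_eliminate:
  fixes f :: "nat \<Rightarrow> nat \<Rightarrow> 'a::idom" and W :: "nat \<Rightarrow> nat \<Rightarrow> 'a"
  assumes tri: "\<And>i j. i < j \<Longrightarrow> j < n \<Longrightarrow> f i j = 0"
    and W: "\<And>i c. i < n \<Longrightarrow> c < m \<Longrightarrow> (\<Sum>j<n + m. f i j * W j c) = 0"
  shows "fdet (n + m) f * fdet m (\<lambda>i c. W (n + i) c) =
    (\<Prod>i<n. f i i) * fdet m (\<lambda>i c. \<Sum>j<n + m. f (n + i) j * W j c)"
proof -
  define B where "B = (\<lambda>i j. if j < n then (if i = j then 1 else 0) else W i (j - n))"
  have B: "fdet (n + m) B = fdet m (\<lambda>i c. W (n + i) c)"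
  proof -
    have "fdet (n + m) B = fdet n B * fdet m (\<lambda>i j. B (n + i) (n + j))"
      by (rule fdet_four_block') (simp add: B_def)
    also have "fdet n B = 1"
      by (subst fdet_lower_triangular) (auto simp: B_def)
    finally show ?thesis
      by (simp add: B_def)
  qed
  define g where "g = (\<lambda>i j. \<Sum>k<n + m. f i k * B k j)"
  have g1: "g i j = f i j" if "j < n" for i j
  proof -
    have "g i j = (\<Sum>k<n + m. if k = j then f i k else 0)"
      unfolding g_def B_def using that by (intro sum.cong) auto
    then show ?thesis
      using that by simp
  qed
  have g2: "g i (n + c) = (\<Sum>j<n + m. f i j * W j c)" for i c
    by (simp add: g_def B_def)
  have "fdet (n + m) f * fdet m (\<lambda>i c. W (n + i) c) = fdet (n + m) g"
    by (simp only: g_def fdet_mult B)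
  also have "\<dots> = fdet n g * fdet m (\<lambda>i c. g (n + i) (n + c))"
    by (rule fdet_four_block) (simp add: g2 W)
  also have "fdet n g = fdet n f"
    by (rule fdet_cong) (simp add: g1)
  also have "\<dots> = (\<Prod>i<n. f i i)"
    by (rule fdet_lower_triangular) (use tri in auto)
  finally show ?thesis
    by (simp add: g2)
qed

lemma fdet_eq_0_right:
  fixes f :: "nat \<Rightarrow> nat \<Rightarrow> 'a::idom"
  assumes "\<And>i. i < n \<Longrightarrow> (\<Sum>j<n. f i j * x j) = 0" and "k < n" "x k \<noteq> 0"
  shows "fdet n f = 0"
proof -
  have "vec n x \<noteq> 0\<^sub>v n"
    using assms(2,3) by (metis index_vec index_zero_vec(1))
  moreover have "mat n n (\<lambda>(i, j). f i j) *\<^sub>v vec n x = 0\<^sub>v n"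
    using assms(1) by (intro eq_vecI) (auto simp: scalar_prod_def atLeast0LessThan)
  ultimately show ?thesis
    unfolding fdet_def by (subst det_0_iff_vec_prod_zero[of _ n]) (auto intro!: exI[of _ "vec n x"])
qed

lemma fdet_expand_row:
  assumes "i < n"
  shows "fdet n f = (\<Sum>j<n. f i j * cofactor (mat n n (\<lambda>(i, j). f i j)) i j)"
  unfolding fdet_def using laplace_expansion_row[of "mat n n (\<lambda>(i, j). f i j)" n i] assms by simp

lemma fdet_2: "fdet 2 f = f 0 0 * f 1 1 - f 0 1 * f 1 0"
  by (subst fdet_expand_row[of 0])
    (auto simp: numeral_2_eq_2 cofactor_def mat_delete_def det_single)

lemma cofactor_replace_row:
  assumes "i < n" "j < n"
  shows "cofactor (mat n n (\<lambda>(k, l). if k = i then u l else f k l)) i j = cofactor (mat n n (\<lambda>(k, l). f k l)) i j"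
  using assms unfolding cofactor_def mat_delete_def
  by (intro arg_cong2[of _ _ _ _ "(*)"] arg_cong[of _ _ det] eq_matI) auto

lemma fdet_replace_row:
  assumes "i < n"
  shows "fdet n (\<lambda>k l. if k = i then u l else f k l) = (\<Sum>j<n. u j * cofactor (mat n n (\<lambda>(k, l). f k l)) i j)"
  by (subst fdet_expand_row[OF assms]) (simp add: cofactor_replace_row assms)

lemma cofactor_transpose:
  assumes "i < n" "j < n"
  shows "cofactor (mat n n (\<lambda>(k, l). f l k)) i j = cofactor (mat n n (\<lambda>(k, l). f k l)) j i"
proof -
  have "mat_delete (mat n n (\<lambda>(k, l). f l k)) i j = transpose_mat (mat_delete (mat n n (\<lambda>(k, l). f k l)) j i)"
    using assms unfolding mat_delete_def by (intro eq_matI) auto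
  moreover have "mat_delete (mat n n (\<lambda>(k, l). f k l)) j i \<in> carrier_mat (n - 1) (n - 1)"
    by (auto simp: mat_delete_def)
  ultimately show ?thesis
    unfolding cofactor_def by (simp add: det_transpose add.commute)
qed

text \<open>Replace row \<open>i\<close> by the row with \<open>x l\<close> in column
  \<open>j\<close> and \<open>- x j\<close> in column \<open>l\<close>. The new row also annihilates
  \<open>x\<close>, so the new determinant is 0; its expansion along row \<open>i\<close> is the
  claim.\<close>

lemma cofactor_row_const:
  fixes f :: "nat \<Rightarrow> nat \<Rightarrow> 'a::idom"
  assumes rows: "\<And>i. i < n \<Longrightarrow> (\<Sum>j<n. f i j * x j) = 0" and "i < n" "j < n" "l < n" "x j \<noteq> 0"
  shows "x l * cofactor (mat n n (\<lambda>(k, l). f k l)) i j = x j * cofactor (mat n n (\<lambda>(k, l). f k l)) i l"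
proof (cases "l = j")
  case False
  let ?u = "\<lambda>k. if k = j then x l else if k = l then - x j else 0"
  have *: "(\<Sum>k<n. ?u k * c k) = x l * c j - x j * c l" for c
  proof -
    have "(\<Sum>k<n. ?u k * c k) = (\<Sum>k<n. (if k = j then x l * c k else 0) + (if k = l then - x j * c k else 0))"
      using False by (intro sum.cong) auto
    then show ?thesis
      using assms by (simp add: sum.distrib)
  qed
  have "fdet n (\<lambda>k l. if k = i then ?u l else f k l) = 0"
  proof (rule fdet_eq_0_right[of _ _ x j])
    show "(\<Sum>c<n. (if k = i then ?u c else f k c) * x c) = 0" if "k < n" for k
      using that rows[OF that] *[of x] by (cases "k = i") (simp_all add: mult.commute)
  qed (use assms in auto)
  then show ?thesis
    using * by (simp add: fdet_replace_row \<open>i < n\<close>)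
qed simp

text \<open>Equivalently, the adjugate matrix is a scalar multiple of \<open>1 v\<^sup>T\<close>.\<close>

lemma cofactor_rank_one:
  fixes f :: "nat \<Rightarrow> nat \<Rightarrow> 'a::idom"
  assumes rows: "\<And>i. i < n \<Longrightarrow> (\<Sum>j<n. f i j) = 0"
    and cols: "\<And>j. j < n \<Longrightarrow> (\<Sum>i<n. v i * f i j) = 0"
    and ij: "i < n" "j < n" "k < n" "l < n" and v: "v i \<noteq> 0"
  shows "v k * cofactor (mat n n (\<lambda>(k, l). f k l)) i j = v i * cofactor (mat n n (\<lambda>(k, l). f k l)) k l"
proof -
  have "v k * cofactor (mat n n (\<lambda>(k, l). f l k)) j i = v i * cofactor (mat n n (\<lambda>(k, l). f l k)) j k"
  proof (rule cofactor_row_const)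
    show "(\<Sum>i<n. f i j * v i) = 0" if "j < n" for j
      using cols[OF that] by (simp add: mult.commute)
  qed (use ij v in auto)
  then have "v k * cofactor (mat n n (\<lambda>(k, l). f k l)) i j = v i * cofactor (mat n n (\<lambda>(k, l). f k l)) k j"
    using cofactor_transpose[OF ij(2,1), of f] cofactor_transpose[OF ij(2,3), of f] by simp
  moreover have "cofactor (mat n n (\<lambda>(k, l). f k l)) k j = cofactor (mat n n (\<lambda>(k, l). f k l)) k l"
    using cofactor_row_const[of n f "\<lambda>_. 1" k j l, OF _ ij(3,2,4)] rows by simp
  ultimately show ?thesis
    by simp
qed

section \<open>Elementary ideals and cofactors\<close>

lemma pick_remove:
  assumes "a < N" "i < N - 1"
  shows "pick ({..<N} - {a}) i = insert_index a i"
proof -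
  let ?S = "{..<N} - {a}"
  have mem: "insert_index a i \<in> ?S"
    using assms by (auto simp: insert_index_def)
  have "{b \<in> ?S. b < insert_index a i} = {..<insert_index a i} - {a}"
    using assms by (auto simp: insert_index_def)
  then have "card {b \<in> ?S. b < insert_index a i} = i"
    by (simp add: insert_index_def)
  then show ?thesis
    using pick_card_in_set[OF mem] by simp
qed

text \<open>Connects the submatrices that define the elementary ideal with the minors that occur in
  cofactors.\<close>

lemma submatrix_remove:
  assumes A: "A \<in> carrier_mat N N" and ab: "a < N" "b < N"
  shows "submatrix A ({..<N} - {a}) ({..<N} - {b}) = mat_delete A a b"
proof -
  have card: "card {i. i < N \<and> i \<in> {..<N} - {c}} = N - 1" if "c < N" for c
  proof -
    have "{i. i < N \<and> i \<in> {..<N} - {c}} = {..<N} - {c}"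
      by auto
    then show ?thesis
      using that by simp
  qed
  have dims: "dim_row A = N" "dim_col A = N"
    using A by auto
  show ?thesis
    unfolding submatrix_def mat_delete_def dims card[OF ab(1)] card[OF ab(2)]
    by (intro eq_matI) (use ab in \<open>auto simp: pick_remove insert_index_def\<close>)
qed

lemma first_minors_square:
  assumes A: "A \<in> carrier_mat N N" and N: "N > 0"
  shows "first_minors A = {det (mat_delete A a b) | a b. a < N \<and> b < N}"
proof -
  have *: "I \<subseteq> {..<N} \<and> card I = N - 1 \<longleftrightarrow> (\<exists>a<N. I = {..<N} - {a})" for I
  proof
    assume I: "I \<subseteq> {..<N} \<and> card I = N - 1"
    then have "card ({..<N} - I) = 1"
      using N by (subst card_Diff_subset) (auto intro: finite_subset)
    then obtain a where "{..<N} - I = {a}"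
      by (auto simp: card_1_singleton_iff)
    then show "\<exists>a<N. I = {..<N} - {a}"
      using I by (intro exI[of _ a]) auto
  qed auto
  have dims: "dim_row A = N" "dim_col A = N"
    using A by auto
  have "first_minors A = {det (submatrix A I J) | I J.
      (I \<subseteq> {..<N} \<and> card I = N - 1) \<and> (J \<subseteq> {..<N} \<and> card J = N - 1)}"
    unfolding first_minors_def dims by (rule Collect_cong) blast
  also have "\<dots> = {det (submatrix A ({..<N} - {a}) ({..<N} - {b})) | a b. a < N \<and> b < N}"
    unfolding * by blast
  also have "\<dots> = {det (mat_delete A a b) | a b. a < N \<and> b < N}"
    by (intro Collect_cong ex_cong1) (auto simp: submatrix_remove[OF A])
  finally show ?thesis .
qed

lemma det_mat_delete_cofactor: "det (mat_delete A a b) = (-1) ^ (a + b) * cofactor A a b"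
  by (simp add: cofactor_def mult.assoc[symmetric] power_add[symmetric] mult_2[symmetric])

section \<open>Equality up to units, and principal elementary ideals\<close>

definition assoc_l :: "laurent \<Rightarrow> laurent \<Rightarrow> bool" where
  "assoc_l a b \<longleftrightarrow> (\<exists>u. lunit u \<and> a = u * b)"

lemma assoc_l_refl [simp]: "assoc_l a a"
  unfolding assoc_l_def by (rule exI[of _ 1]) simp

lemma assoc_l_sym: "assoc_l a b \<Longrightarrow> assoc_l b a"
  unfolding assoc_l_def
proof (elim exE conjE)
  fix u assume "lunit u" and a: "a = u * b"
  then obtain v where "lunit v" "u * v = 1"
    using lunit_inverse by blast
  then have "b = v * a"
    using a by (metis mult.assoc mult.commute mult_1)
  then show "\<exists>u. lunit u \<and> b = u * a"
    using \<open>lunit v\<close> by blast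
qed

lemma assoc_l_trans [trans]: "assoc_l a b \<Longrightarrow> assoc_l b c \<Longrightarrow> assoc_l a c"
  unfolding assoc_l_def by (metis lunit_mult mult.assoc)

lemma assoc_l_mult_left: "assoc_l a b \<Longrightarrow> assoc_l (c * a) (c * b)"
  unfolding assoc_l_def by (metis mult.left_commute)

lemma assoc_l_unit: "lunit u \<Longrightarrow> assoc_l (u * a) a"
  unfolding assoc_l_def by blast

lemma assoc_l_eqI: "u * a = v * b \<Longrightarrow> lunit u \<Longrightarrow> lunit v \<Longrightarrow> assoc_l a b"
  by (metis assoc_l_sym assoc_l_trans assoc_l_unit)

text \<open>For nonzero elements the two quotients multiply to 1 by cancellation, so they are units,
  and all units are known. Thus greatest common divisors are determined up to a sign and a power of
  t.\<close>

lemma assoc_l_iff_dvd: "assoc_l a b \<longleftrightarrow> a dvd b \<and> b dvd a"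
proof
  assume "assoc_l a b"
  then show "a dvd b \<and> b dvd a"
    using assoc_l_sym unfolding assoc_l_def by (metis dvd_triv_right)
next
  assume ab: "a dvd b \<and> b dvd a"
  then obtain u v where uv: "a = u * b" "b = v * a"
    unfolding dvd_def by (metis mult.commute)
  show "assoc_l a b"
  proof (cases "b = 0")
    case False
    have "b * (v * u) = b * 1"
      using uv by (metis mult.assoc mult.commute mult_1_right)
    then have "u dvd 1"
      using False by (metis dvd_triv_right mult_cancel_left)
    then show ?thesis
      unfolding assoc_l_def using uv dvd_one_imp_lunit by blast
  next
    case True
    then have "a = b"
      using ab by simp
    then show ?thesis
      by simp
  qed
qed

text \<open>The constant vector in the right kernel and the units \<open>v\<close> in the left
  kernel make all cofactors associated. Hence the minors have the same common divisors as any single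
  cofactor, and their greatest common divisors are its associates.\<close>

lemma first_elementary_ideal_principal:
  assumes N: "N > 0" and "length rels = N"
    and rows: "\<And>i. i < N \<Longrightarrow> (\<Sum>j<N. fox j (rels ! i)) = 0"
    and cols: "\<And>j. j < N \<Longrightarrow> (\<Sum>i<N. v i * fox j (rels ! i)) = 0"
    and v: "\<And>i. i < N \<Longrightarrow> lunit (v i)"
    and ab: "a < N" "b < N"
  shows "is_alexander_polynomial N rels D \<longleftrightarrow>
    assoc_l D (cofactor (mat N N (\<lambda>(i, j). fox j (rels ! i))) a b)"
proof -
  define A where "A = mat N N (\<lambda>(i, j). fox j (rels ! i))"
  have AM: "alexander_matrix N rels = A"
    unfolding alexander_matrix_def A_def using assms(2) by simp
  have A: "A \<in> carrier_mat N N"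
    by (simp add: A_def)
  have minor: "assoc_l (det (mat_delete A i j)) (cofactor A a b)" if "i < N" "j < N" for i j
  proof -
    have "v a * cofactor A i j = v i * cofactor A a b"
      unfolding A_def
      by (rule cofactor_rank_one) (use rows cols ab that v lunit_nonzero in auto)
    then have "assoc_l (cofactor A i j) (cofactor A a b)"
      using v ab that by (intro assoc_l_eqI)
    moreover have "assoc_l (det (mat_delete A i j)) (cofactor A i j)"
      unfolding det_mat_delete_cofactor by (intro assoc_l_unit) (auto simp: minus_one_power_iff)
    ultimately show ?thesis
      using assoc_l_trans by blast
  qed
  have mem: "det (mat_delete A a b) \<in> first_minors A"
    using first_minors_square[OF A N] ab by blast
  have dvd_iff: "(\<forall>x \<in> first_minors A. d dvd x) \<longleftrightarrow> d dvd cofactor A a b" for d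
  proof
    assume "\<forall>x \<in> first_minors A. d dvd x"
    then have "d dvd det (mat_delete A a b)"
      using mem by blast
    then show "d dvd cofactor A a b"
      using minor[OF ab] unfolding assoc_l_iff_dvd by (meson dvd_trans)
  next
    assume d: "d dvd cofactor A a b"
    show "\<forall>x \<in> first_minors A. d dvd x"
      unfolding first_minors_square[OF A N] using minor d unfolding assoc_l_iff_dvd
      by (blast intro: dvd_trans)
  qed
  show ?thesis
    unfolding is_alexander_polynomial_def AM dvd_iff A_def[symmetric] assoc_l_iff_dvd
    by (metis dvd_refl dvd_trans)
qed

section \<open>The Alexander matrix of a closed braid\<close>

text \<open>The derivation with value \<open>x g\<close> on generator \<open>g\<close>, evaluated on
  a word. By \<open>sum_fox\<close> this is the row of Fox derivatives of the word applied to the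
  vector \<open>x\<close>.\<close>

fun fval :: "fword \<Rightarrow> (nat \<Rightarrow> laurent) \<Rightarrow> laurent" where
  "fval [] x = 0"
| "fval ((g, True) # w) x = x g + tpow 1 * fval w x"
| "fval ((g, False) # w) x = tpow (-1) * (fval w x - x g)"

lemma sum_fox:
  assumes "\<And>g b. (g, b) \<in> set w \<Longrightarrow> g < n"
  shows "(\<Sum>j<n. fox j w * x j) = fval w x"
  using assms
proof (induction w x rule: fval.induct)
  case (2 g w x)
  then have IH: "(\<Sum>j<n. fox j w * x j) = fval w x" and g: "g < n"
    by auto
  have "(\<Sum>j<n. fox j ((g, True) # w) * x j) =
    (\<Sum>j<n. (if g = j then x j else 0) + tpow 1 * (fox j w * x j))"
    by (intro sum.cong) (auto simp: algebra_simps)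
  then show ?case
    using g by (simp add: sum.distrib sum_distrib_left[symmetric] IH)
next
  case (3 g w x)
  then have IH: "(\<Sum>j<n. fox j w * x j) = fval w x" and g: "g < n"
    by auto
  have "(\<Sum>j<n. fox j ((g, False) # w) * x j) =
    (\<Sum>j<n. tpow (-1) * (fox j w * x j) - (if g = j then tpow (-1) * x j else 0))"
    by (intro sum.cong) (auto simp: algebra_simps)
  also have "\<dots> = tpow (-1) * (\<Sum>j<n. fox j w * x j) - tpow (-1) * x g"
    using g by (simp add: sum_subtractf sum_distrib_left)
  finally show ?case
    by (simp add: IH right_diff_distrib)
qed simp

text \<open>The unreduced Burau action, read off by evaluating the derivation on
  \<open>meridian_after\<close>: for example x_i x_(i+1) x_i^(-1) has value (1 - t) x_i + t
  x_(i+1).\<close>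

fun burau :: "nat \<times> bool \<Rightarrow> (nat \<Rightarrow> laurent) \<Rightarrow> nat \<Rightarrow> laurent" where
  "burau (i, True) x = x(i := (1 - tpow 1) * x i + tpow 1 * x (i + 1), i + 1 := x i)"
| "burau (i, False) x = x(i := x (i + 1), i + 1 := tpow (-1) * x i + (1 - tpow (-1)) * x (i + 1))"

lemma fval_meridian_after:
  "fval (meridian_after n k c j) x = burau c (\<lambda>j. x (edge n k j)) j"
  by (cases "(c, \<lambda>j. x (edge n k j))" rule: burau.cases)
    (auto simp: meridian_after_def algebra_simps tpow_mult tpow_mult_left)

definition valid_braid :: "nat \<Rightarrow> braid_word \<Rightarrow> bool" where
  "valid_braid n w \<longleftrightarrow> (\<forall>c \<in> set w. 1 \<le> fst c \<and> fst c < n)"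

lemma set_meridian_after:
  assumes "1 \<le> fst c" "fst c < n" "1 \<le> j" "j \<le> n" "(g, b) \<in> set (meridian_after n k c j)"
  shows "k * n \<le> g" "g < (k + 1) * n"
proof -
  obtain i s where c: "c = (i, s)"
    by (cases c)
  have "\<exists>l. 1 \<le> l \<and> l \<le> n \<and> g = edge n k l"
    using assms unfolding c meridian_after_def
    by (cases s) (auto split: if_splits intro: exI[of _ i] exI[of _ "Suc i"])
  then show "k * n \<le> g" "g < (k + 1) * n"
    by (auto simp: edge_def)
qed

lemma length_concat_uniform:
  "(\<And>xs. xs \<in> set xss \<Longrightarrow> length xs = n) \<Longrightarrow> length (concat xss) = length xss * n"
  by (induction xss) auto

lemma nth_concat_uniform:
  "(\<And>xs. xs \<in> set xss \<Longrightarrow> length xs = n) \<Longrightarrow> k < length xss \<Longrightarrow> j < n \<Longrightarrow>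
   concat xss ! (k * n + j) = xss ! k ! j"
proof (induction xss arbitrary: k)
  case (Cons xs xss)
  then show ?case
    by (cases k) (auto simp: nth_append)
qed simp

lemma length_closure_relators: "length (closure_relators n w) = (length w + 1) * n"
  unfolding closure_relators_def
  by (subst length_append, subst length_concat_uniform[where n = n]) (auto simp del: upt_Suc)

lemma closure_row_index: "k < L \<Longrightarrow> j < n \<Longrightarrow> k * n + j < L * n" for k L j n :: nat
  by (metis add_less_le_mono add.commute mult_Suc mult_le_mono1 Suc_leI nat_add_left_cancel_less less_le_trans)

lemma closure_relators_nth:
  assumes "k < length w" "j < n"
  shows "closure_relators n w ! (k * n + j) =
    (edge n (k + 1) (j + 1), False) # meridian_after n k (w ! k) (j + 1)"
proof -
  let ?xss = "map (\<lambda>k. map (\<lambda>j. (edge n (k + 1) j, False) # meridian_after n k (w ! k) j) [1..<n + 1]) [0..<length w]"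
  have len: "length (concat ?xss) = length w * n"
    by (subst length_concat_uniform[where n = n]) auto
  have "k * n + j < length w * n"
    using assms by (rule closure_row_index)
  then have "closure_relators n w ! (k * n + j) = concat ?xss ! (k * n + j)"
    unfolding closure_relators_def using len by (simp add: nth_append)
  also have "\<dots> = ?xss ! k ! j"
    by (rule nth_concat_uniform) (use assms in auto)
  finally show ?thesis
    using assms by (simp del: upt_Suc)
qed

lemma closure_relators_nth_last:
  assumes "j < n"
  shows "closure_relators n w ! (length w * n + j) = [(edge n (length w) (j + 1), False), (edge n 0 (j + 1), True)]"
proof -
  let ?xss = "map (\<lambda>k. map (\<lambda>j. (edge n (k + 1) j, False) # meridian_after n k (w ! k) j) [1..<n + 1]) [0..<length w]"
  have "length (concat ?xss) = length w * n"
    by (subst length_concat_uniform[where n = n]) auto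
  then show ?thesis
    unfolding closure_relators_def using assms by (simp add: nth_append del: upt_Suc)
qed

lemma closure_row_cases:
  fixes i L n :: nat
  assumes "i < (L + 1) * n"
  obtains (step) k j where "k < L" "j < n" "i = k * n + j" | (last) j where "j < n" "i = L * n + j"
proof (cases "i < L * n")
  case True
  then have "i div n < L" "i mod n < n"
    by (auto simp: less_mult_imp_div_less intro!: mod_less_divisor gr0I)
  then show ?thesis
    by (intro step[of "i div n" "i mod n"]) auto
next
  case False
  then show ?thesis
    using assms by (intro last[of "i - L * n"]) auto
qed

text \<open>The relator begins with the inverse of the outgoing meridian; this produces the factor
  t^(-1) and the subtracted term.\<close>

lemma sum_fox_step:
  assumes "valid_braid n w" "k < length w" "j < n"
  shows "(\<Sum>g<(length w + 1) * n. fox g (closure_relators n w ! (k * n + j)) * x g) =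
    tpow (-1) * (burau (w ! k) (\<lambda>j. x (edge n k j)) (j + 1) - x ((k + 1) * n + j))"
proof -
  have c: "1 \<le> fst (w ! k)" "fst (w ! k) < n"
    using assms(1) nth_mem[OF assms(2)] unfolding valid_braid_def by auto
  have le: "(k + 2) * n \<le> (length w + 1) * n"
    using assms(2) by (intro mult_le_mono1) simp
  have "(\<Sum>g<(length w + 1) * n. fox g (closure_relators n w ! (k * n + j)) * x g) =
    fval (closure_relators n w ! (k * n + j)) x"
  proof (rule sum_fox)
    fix g b assume "(g, b) \<in> set (closure_relators n w ! (k * n + j))"
    then consider "g = edge n (k + 1) (j + 1)" | "(g, b) \<in> set (meridian_after n k (w ! k) (j + 1))"
      using assms by (auto simp: closure_relators_nth)
    then have "g < (k + 2) * n"
    proof cases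
      case 1
      then show ?thesis using assms by (simp add: edge_def)
    next
      case 2
      then show ?thesis
        using set_meridian_after(2)[OF c _ _ 2] assms by simp
    qed
    then show "g < (length w + 1) * n"
      using le by linarith
  qed
  then show ?thesis
    using assms by (simp add: closure_relators_nth fval_meridian_after edge_def)
qed

lemma sum_fox_last:
  assumes "j < n"
  shows "(\<Sum>g<(length w + 1) * n. fox g (closure_relators n w ! (length w * n + j)) * x g) =
    tpow (-1) * (x j - x (length w * n + j))"
proof -
  have "(\<Sum>g<(length w + 1) * n. fox g (closure_relators n w ! (length w * n + j)) * x g) =
    fval (closure_relators n w ! (length w * n + j)) x"
    by (rule sum_fox) (use assms in \<open>auto simp: closure_relators_nth_last edge_def\<close>)
  then show ?thesis
    using assms by (simp add: closure_relators_nth_last edge_def)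
qed

section \<open>The coordinates y_j of the partial products of meridians\<close>

definition psum :: "(nat \<Rightarrow> laurent) \<Rightarrow> nat \<Rightarrow> laurent" where
  "psum x j = (\<Sum>i<j. tpow (int i) * x (i + 1))"

lemma psum_0 [simp]: "psum x 0 = 0"
  by (simp add: psum_def)

lemma psum_Suc: "psum x (Suc j) = psum x j + tpow (int j) * x (Suc j)"
  by (simp add: psum_def)

lemma psum_cong: "(\<And>i. 1 \<le> i \<Longrightarrow> i \<le> j \<Longrightarrow> x i = x' i) \<Longrightarrow> psum x j = psum x' j"
  unfolding psum_def by (intro sum.cong) auto

lemma psum_upd: "j < i \<Longrightarrow> psum (x(i := a)) j = psum x j"
  by (rule psum_cong) simp

lemma psum_burau_lt: "j < i \<Longrightarrow> psum (burau (i, b) x) j = psum x j"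
  by (cases b) (simp_all add: psum_upd)

lemma psum_burau_True_eq:
  "psum (burau (Suc i, True) x) (Suc i) = psum x (Suc (Suc i)) - tpow 1 * psum x (Suc i) + tpow 1 * psum x i"
  by (simp add: psum_Suc psum_upd algebra_simps tpow_collect)

text \<open>The two new meridians at positions i and i + 1 have the same product x_i x_(i+1) as the
  old ones, so every longer partial product is unchanged.\<close>

lemma psum_burau_gt:
  assumes "1 \<le> i" "i < j"
  shows "psum (burau (i, b) x) j = psum x j"
proof -
  obtain k where i: "i = Suc k"
    using assms by (cases i) auto
  from \<open>i < j\<close> have "Suc i \<le> j"
    by simp
  then show ?thesis
  proof (induction j rule: dec_induct)
    case base
    show ?case
      unfolding i by (cases b) (simp_all add: psum_Suc psum_upd algebra_simps tpow_collect del: fun_upd_apply, simp_all add: algebra_simps tpow_collect)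
  next
    case (step j)
    then show ?case
      by (cases b) (simp_all add: psum_Suc)
  qed
qed

lemma psum_burau_neq: "1 \<le> i \<Longrightarrow> j \<noteq> i \<Longrightarrow> psum (burau (i, b) x) j = psum x j"
  using psum_burau_gt psum_burau_lt by (metis linorder_neqE_nat)

lemma sum_lessThan_add: "(\<Sum>i<a + b. h i) = (\<Sum>i<a. h i) + (\<Sum>j<b. h (a + j :: nat))" for h :: "nat \<Rightarrow> 'a::comm_monoid_add"
  by (induction b) (simp_all add: ac_simps)

lemma sum_blocks: "(\<Sum>i<L * n. h i) = (\<Sum>k<L. \<Sum>j<n. h (k * n + j :: nat))" for h :: "nat \<Rightarrow> 'a::comm_monoid_add"
proof (induction L)
  case (Suc L)
  have "(\<Sum>i<Suc L * n. h i) = (\<Sum>i<L * n + n. h i)"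
    by (simp add: add.commute)
  then show ?case
    using Suc by (simp only: sum_lessThan_add sum.lessThan_Suc)
qed simp

lemma burau_const: "burau c (\<lambda>_. 1) = (\<lambda>_. 1)"
  by (cases "(c, \<lambda>_ :: nat. 1 :: laurent)" rule: burau.cases) auto

lemma burau_cong:
  assumes "1 \<le> fst c" "fst c < n" "\<And>j. 1 \<le> j \<Longrightarrow> j \<le> n \<Longrightarrow> x j = x' j" "1 \<le> j" "j \<le> n"
  shows "burau c x j = burau c x' j"
proof -
  obtain i b where c: "c = (i, b)"
    by (cases c)
  show ?thesis
    using assms unfolding c by (cases b) auto
qed

section \<open>Right and left kernel of the Alexander matrix\<close>

definition relval :: "nat \<Rightarrow> braid_word \<Rightarrow> nat \<Rightarrow> (nat \<Rightarrow> laurent) \<Rightarrow> laurent" where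
  "relval n w i x = (\<Sum>g<(length w + 1) * n. fox g (closure_relators n w ! i) * x g)"

lemma relval_step:
  assumes "valid_braid n w" "k < length w" "j < n"
  shows "relval n w (k * n + j) x =
    tpow (-1) * (burau (w ! k) (\<lambda>j. x (edge n k j)) (j + 1) - x ((k + 1) * n + j))"
  unfolding relval_def by (rule sum_fox_step[OF assms])

lemma relval_last:
  assumes "j < n"
  shows "relval n w (length w * n + j) x = tpow (-1) * (x j - x (length w * n + j))"
  unfolding relval_def by (rule sum_fox_last[OF assms])

lemma relval_const:
  assumes "valid_braid n w" "i < (length w + 1) * n"
  shows "relval n w i (\<lambda>_. 1) = 0"
  using assms(2)
proof (cases rule: closure_row_cases)
  case (step k j)
  then show ?thesis
    using relval_step[OF assms(1), of k j "\<lambda>_. 1"] by (simp add: burau_const)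
next
  case (last j)
  then show ?thesis
    using relval_last[of j n w "\<lambda>_. 1"] by simp
qed

text \<open>The weights are the coefficients of y_n. Every letter preserves y_n, so the weighted
  rows of the letters telescope to a difference between the first and the last level; the closing
  rows carry the opposite sign and cancel it.\<close>

definition row_weight :: "nat \<Rightarrow> braid_word \<Rightarrow> nat \<Rightarrow> laurent" where
  "row_weight n w i = (if i < length w * n then tpow (int (i mod n)) else - tpow (int (i mod n)))"

lemma row_weight_step: "k < length w \<Longrightarrow> j < n \<Longrightarrow> row_weight n w (k * n + j) = tpow (int j)"
  using closure_row_index[of k "length w" j n] by (simp add: row_weight_def)

lemma row_weight_last: "j < n \<Longrightarrow> row_weight n w (length w * n + j) = - tpow (int j)"
  by (simp add: row_weight_def)

lemma relval_left_kernel: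
  assumes w: "valid_braid n w"
  shows "(\<Sum>i<(length w + 1) * n. row_weight n w i * relval n w i x) = 0"
proof -
  let ?L = "length w"
  define y where "y = (\<lambda>k. psum (\<lambda>j. x (edge n k j)) n)"
  have y: "(\<Sum>j<n. tpow (int j) * x (k * n + j)) = y k" for k
    by (simp add: y_def psum_def edge_def)
  have steps: "(\<Sum>j<n. row_weight n w (k * n + j) * relval n w (k * n + j) x) = tpow (-1) * (y k - y (k + 1))"
    if k: "k < ?L" for k
  proof -
    have c: "1 \<le> fst (w ! k)"  "fst (w ! k) < n"
      using w nth_mem[OF k] unfolding valid_braid_def by auto
    have "(\<Sum>j<n. row_weight n w (k * n + j) * relval n w (k * n + j) x) =
      (\<Sum>j<n. tpow (-1) * (tpow (int j) * burau (w ! k) (\<lambda>j. x (edge n k j)) (j + 1) - tpow (int j) * x ((k + 1) * n + j)))"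
      by (intro sum.cong refl) (simp add: row_weight_step[OF k] relval_step[OF w k] right_diff_distrib mult.left_commute)
    also have "\<dots> = tpow (-1) * (psum (burau (w ! k) (\<lambda>j. x (edge n k j))) n - y (k + 1))"
      by (simp only: sum_distrib_left[symmetric] sum_subtractf y psum_def)
    also have "psum (burau (w ! k) (\<lambda>j. x (edge n k j))) n = y k"
      unfolding y_def using psum_burau_gt[OF c, of "snd (w ! k)"] by simp
    finally show ?thesis .
  qed
  have last: "(\<Sum>j<n. row_weight n w (?L * n + j) * relval n w (?L * n + j) x) = - tpow (-1) * (y 0 - y ?L)"
  proof -
    have "(\<Sum>j<n. row_weight n w (?L * n + j) * relval n w (?L * n + j) x) =
      (\<Sum>j<n. - tpow (-1) * (tpow (int j) * x (0 * n + j) - tpow (int j) * x (?L * n + j)))"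
      by (intro sum.cong refl) (simp add: row_weight_last relval_last right_diff_distrib mult.left_commute)
    then show ?thesis
      by (simp only: sum_distrib_left[symmetric] sum_subtractf y)
  qed
  have tel: "(\<Sum>k<K. tpow (-1) * (y k - y (k + 1))) = tpow (-1) * (y 0 - y K)" for K
    by (induction K) (simp_all add: algebra_simps)
  have N: "(?L + 1) * n = ?L * n + n"
    by simp
  have "(\<Sum>k<?L. \<Sum>j<n. row_weight n w (k * n + j) * relval n w (k * n + j) x) = tpow (-1) * (y 0 - y ?L)"
    unfolding tel[symmetric] by (intro sum.cong refl steps) simp
  then show ?thesis
    unfolding N sum_lessThan_add sum_blocks last by (simp add: algebra_simps)
qed

lemma fox_column_relation:
  assumes w: "valid_braid n w" and g: "g < (length w + 1) * n"
  shows "(\<Sum>i<(length w + 1) * n. row_weight n w i * fox g (closure_relators n w ! i)) = 0"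
proof -
  have "relval n w i (\<lambda>h. if h = g then 1 else 0) = fox g (closure_relators n w ! i)" for i
    using g unfolding relval_def by (simp add: if_distrib[of "\<lambda>x. _ * x"] cong: if_cong)
  then show ?thesis
    using relval_left_kernel[OF w, of "\<lambda>h. if h = g then 1 else 0"] by simp
qed

section \<open>Elimination of the meridians level by level\<close>

lemma fox_not_mem: "j \<notin> fst ` set w \<Longrightarrow> fox j w = 0"
  by (induction j w rule: fox.induct) auto

text \<open>Chosen so that its only nonzero coordinate y_j is y_(c+1) = t^(c+1). In these vectors
  the condition y_n = 0 just omits the last one.\<close>

definition bump :: "nat \<Rightarrow> nat \<Rightarrow> laurent" where
  "bump c j = (if j = c + 1 then tpow 1 else if j = c + 2 then - 1 else 0)"

lemma psum_bump: "psum (bump c) j = (if j = c + 1 then tpow (int (c + 1)) else 0)"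
proof (induction j)
  case (Suc j)
  then show ?case
    by (auto simp: psum_Suc bump_def tpow_mult add.commute)
qed simp

text \<open>The last relator is replaced by the functional y_n on level 0. The letter relators
  determine each level from the previous one, so only level 0 survives. In the coordinates y_j the
  closing rows become the Burau matrix minus the identity, and the replaced row splits off
  y_n.\<close>

lemma closure_det:
  assumes w: "valid_braid n w" and n: "n = Suc m"
    and u: "u = (\<lambda>g. if g < n then tpow (int g) else 0)"
  shows "assoc_l (fdet ((length w + 1) * n)
      (\<lambda>i g. if i = (length w + 1) * n - 1 then u g else fox g (closure_relators n w ! i)))
    (fdet m (\<lambda>i c. psum (fold burau w (bump c)) (i + 1) - psum (bump c) (i + 1)))"
proof -
  define L where "L = length w"
  define N where "N = (L + 1) * n"
  define F where "F = (\<lambda>i g. if i = N - 1 then u g else fox g (closure_relators n w ! i))"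
  \<comment> \<open>A cyclic shift of the columns by one level: the outgoing meridians of a letter
    move to the diagonal of its rows, and level 0 comes last.\<close>
  define \<gamma> where "\<gamma> = (\<lambda>c. if c < N then (c + n) mod N else c)"
  \<comment> \<open>The vector \<open>bump c\<close> transported from level 0 to the level of
    \<open>g\<close>; it satisfies all letter relators.\<close>
  define S where "S = (\<lambda>c g. fold burau (take (g div n) w) (bump c) (g mod n + 1))"
  have N': "N = L * n + n"
    by (simp add: N_def)
  have \<gamma>1: "\<gamma> c = c + n" if "c < L * n" for c
    using that by (simp add: \<gamma>_def N')
  have \<gamma>2: "\<gamma> (L * n + c) = c" if "c < n" for c
  proof -
    have "(L * n + c + n) mod (L * n + n) = (c + (L * n + n)) mod (L * n + n)"
      by (simp only: ac_simps)
    then show ?thesis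
      using that by (simp add: \<gamma>_def N' trans_less_add2)
  qed
  have \<gamma>: "\<gamma> permutes {..<N}"
  proof (rule bij_imp_permutes)
    have "inj_on \<gamma> {..<N}"
    proof (rule inj_onI)
      fix a b assume ab: "a \<in> {..<N}" "b \<in> {..<N}" "\<gamma> a = \<gamma> b"
      have "\<gamma> c = (if c < L * n then c + n else c - L * n)" if "c \<in> {..<N}" for c
        using that \<gamma>1[of c] \<gamma>2[of "c - L * n"] unfolding N' by auto
      then show "a = b"
        using ab unfolding N' by (simp split: if_splits)
    qed
    moreover have "\<gamma> ` {..<N} \<subseteq> {..<N}"
      using n by (auto simp: \<gamma>_def N')
    ultimately show "bij_betw \<gamma> {..<N} {..<N}"
      by (simp add: bij_betw_def endo_inj_surj)
  qed (simp add: \<gamma>_def)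
  obtain e where e: "lunit e" "fdet N (\<lambda>i j. F i (\<gamma> j)) = e * fdet N F"
    using fdet_permute_cols[OF \<gamma>, of F] by (metis insert_iff lunit_1 lunit_uminus singletonD)
  have Fval: "(\<Sum>j<N. F i (\<gamma> j) * S c (\<gamma> j)) = relval n w i (S c)" if "i < N - 1" for i c
    unfolding sum.permute[OF \<gamma>, of "\<lambda>g. F i g * S c g", symmetric, unfolded o_def]
    using that by (simp add: F_def relval_def N_def L_def)
  have S_edge: "S c (k * n + j) = fold burau (take k w) (bump c) (j + 1)" if "j < n" for c k j
    using that by (simp add: S_def)
  have S_step: "relval n w (k * n + j) (S c) = 0" if k: "k < L" and j: "j < n" for k j c
  proof -
    have c: "1 \<le> fst (w ! k)"  "fst (w ! k) < n"
      using w nth_mem k unfolding valid_braid_def L_def by auto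
    have "burau (w ! k) (\<lambda>j. S c (edge n k j)) (j + 1) = burau (w ! k) (fold burau (take k w) (bump c)) (j + 1)"
    proof (rule burau_cong[OF c])
      fix l :: nat
      assume l: "1 \<le> l" "l \<le> n"
      then have "edge n k l = k * n + (l - 1)" "l - 1 < n"
        by (auto simp: edge_def)
      then show "S c (edge n k l) = fold burau (take k w) (bump c) l"
        using S_edge[of "l - 1" c k] l by simp
    qed (use j in auto)
    also have "\<dots> = fold burau (take (Suc k) w) (bump c) (j + 1)"
      using k by (simp add: take_Suc_conv_app_nth L_def)
    also have "\<dots> = S c ((k + 1) * n + j)"
      using S_edge[OF j, of c "k + 1"] by simp
    finally show ?thesis
      using relval_step[OF w _ j, of k "S c"] k by (simp add: L_def)
  qed
  have rel_lt: "i < L * n \<Longrightarrow> \<exists>k j. k < L \<and> j < n \<and> i = k * n + j" for i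
    by (rule closure_row_cases[of i L n]) (auto simp: add.commute)
  have tri: "F i (\<gamma> j) = (if i = j then - tpow (-1) else 0)" if ij: "i \<le> j" "j < L * n" for i j
  proof -
    obtain k l where i: "k < L" "l < n" "i = k * n + l"
      using rel_lt[OF le_less_trans[OF ij]] by blast
    have c: "1 \<le> fst (w ! k)"  "fst (w ! k) < n"
      using w nth_mem i unfolding valid_braid_def L_def by auto
    have "F i (\<gamma> j) = fox (j + n) ((edge n (k + 1) (l + 1), False) # meridian_after n k (w ! k) (l + 1))"
      using that i closure_relators_nth[of k w l n] n unfolding F_def by (simp add: \<gamma>1 N' L_def)
    also have "fox (j + n) (meridian_after n k (w ! k) (l + 1)) = 0"
    proof (rule fox_not_mem, rule notI)
      assume "j + n \<in> fst ` set (meridian_after n k (w ! k) (l + 1))"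
      then have "j + n < (k + 1) * n"
        using set_meridian_after(2)[OF c, of "l + 1" "j + n" _ k] i by auto
      then show False
        using that i by simp
    qed
    then have "fox (j + n) ((edge n (k + 1) (l + 1), False) # meridian_after n k (w ! k) (l + 1)) = 
      - (if edge n (k + 1) (l + 1) = j + n then tpow (-1) else 0)"
      by simp
    also have "edge n (k + 1) (l + 1) = i + n"
      by (simp add: edge_def i)
    finally show ?thesis
      by auto
  qed
  \<comment> \<open>Elimination along the solutions \<open>S c\<close>. Their free coordinates on
    level 0 are the vectors \<open>bump c\<close>, which form a triangular matrix with unit
    determinant.\<close>
  have "fdet (L * n + n) (\<lambda>i j. F i (\<gamma> j)) * fdet n (\<lambda>i c. S c (\<gamma> (L * n + i))) =
    (\<Prod>i<L * n. F i (\<gamma> i)) * fdet n (\<lambda>i c. \<Sum>j<L * n + n. F (L * n + i) (\<gamma> j) * S c (\<gamma> j))"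
  proof (rule fdet_eliminate)
    show "(\<Sum>j<L * n + n. F i (\<gamma> j) * S c (\<gamma> j)) = 0" if "i < L * n" for i c
    proof -
      have "i < N - 1"
        using that n by (simp add: N')
      then show ?thesis
        using Fval S_step rel_lt[OF that] by (auto simp: N')
    qed
  qed (use tri in auto)
  also have "fdet n (\<lambda>i c. S c (\<gamma> (L * n + i))) = fdet n (\<lambda>i c. bump c (i + 1))"
    by (rule fdet_cong) (simp add: \<gamma>2 S_def)
  also have "\<dots> = tpow (int n)"
    by (subst fdet_lower_triangular) (auto simp: bump_def tpow_power)
  also have "(\<Prod>i<L * n. F i (\<gamma> i)) = (- tpow (-1)) ^ (L * n)"
    using tri by simp
  also have "fdet n (\<lambda>i c. \<Sum>j<L * n + n. F (L * n + i) (\<gamma> j) * S c (\<gamma> j)) =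
    fdet n (\<lambda>i c. if i = m then psum (bump c) n else tpow (-1) * (bump c (i + 1) - fold burau w (bump c) (i + 1)))"
  proof (rule fdet_cong)
    fix i c assume ic: "i < n" "c < n"
    show "(\<Sum>j<L * n + n. F (L * n + i) (\<gamma> j) * S c (\<gamma> j)) =
      (if i = m then psum (bump c) n else tpow (-1) * (bump c (i + 1) - fold burau w (bump c) (i + 1)))"
    proof (cases "i = m")
      case True
      have "(\<Sum>j<N. F (L * n + i) (\<gamma> j) * S c (\<gamma> j)) = (\<Sum>g<N. u g * S c g)"
        unfolding sum.permute[OF \<gamma>, of "\<lambda>g. F _ g * S c g", symmetric, unfolded o_def]
        using True n by (simp add: F_def N')
      also have "\<dots> = (\<Sum>g<n. tpow (int g) * bump c (g + 1))"
        unfolding N' add.commute[of "L * n"] sum_lessThan_add by (simp add: u S_def)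
      finally show ?thesis
        using True by (simp add: N' psum_def)
    next
      case False
      then have "L * n + i < N - 1"
        using ic n by (simp add: N')
      then have "(\<Sum>j<N. F (L * n + i) (\<gamma> j) * S c (\<gamma> j)) = relval n w (L * n + i) (S c)"
        by (rule Fval)
      also have "\<dots> = tpow (-1) * (S c i - S c (L * n + i))"
        using relval_last[OF ic(1)] by (simp add: L_def)
      finally show ?thesis
        using False S_edge[OF ic(1), of c L] S_edge[OF ic(1), of c 0] by (simp add: N' L_def)
    qed
  qed
  finally have eq1: "fdet N (\<lambda>i j. F i (\<gamma> j)) * tpow (int n) = (- tpow (-1)) ^ (L * n) *
    fdet n (\<lambda>i c. if i = m then psum (bump c) n else tpow (-1) * (bump c (i + 1) - fold burau w (bump c) (i + 1)))"
    (is "_ = _ * fdet n ?G")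
    by (simp add: N')
  \<comment> \<open>Row operations that turn the closing rows into weighted partial sums, that is,
    into y_1, ..., y_m. The last row is already y_n and is kept.\<close>
  define T where "T = (\<lambda>i k. if i = m then (if k = m then 1 else 0) else if k \<le> i then tpow (int k) else 0 :: laurent)"
  have "fdet n T * fdet n ?G = fdet n (\<lambda>i c. \<Sum>k<n. T i k * ?G k c)"
    by (simp only: fdet_mult)
  also have "\<dots> = fdet n (\<lambda>i c. if i = m then psum (bump c) n else tpow (-1) * (psum (bump c) (i + 1) - psum (fold burau w (bump c)) (i + 1)))"
  proof (rule fdet_cong)
    fix i c assume ic: "i < n" "c < n"
    show "(\<Sum>k<n. T i k * ?G k c) =
      (if i = m then psum (bump c) n else tpow (-1) * (psum (bump c) (i + 1) - psum (fold burau w (bump c)) (i + 1)))"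
    proof (cases "i = m")
      case False
      have "(\<Sum>k<n. T i k * ?G k c) = (\<Sum>k<i + 1. T i k * ?G k c)"
        by (rule sum.mono_neutral_right) (use ic False n in \<open>auto simp: T_def\<close>)
      also have "\<dots> = (\<Sum>k<i + 1. tpow (-1) * (tpow (int k) * bump c (k + 1) - tpow (int k) * fold burau w (bump c) (k + 1)))"
        using ic False n by (intro sum.cong refl) (auto simp: T_def algebra_simps)
      finally show ?thesis
        using False by (simp only: sum_distrib_left[symmetric] sum_subtractf psum_def if_False)
    qed (simp add: T_def n)
  qed
  \<comment> \<open>In the last row \<open>psum (bump c) n\<close> vanishes for
    \<open>c < m\<close>, so the matrix is block triangular with a corner entry t^n.\<close>
  also have "\<dots> = fdet m (\<lambda>i c. tpow (-1) * (psum (bump c) (i + 1) - psum (fold burau w (bump c)) (i + 1))) * tpow (int n)"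
    unfolding n Suc_eq_plus1
    by (subst fdet_four_block') (auto simp: psum_bump fdet_def det_single cong: fdet_cong)
  also have "fdet m (\<lambda>i c. tpow (-1) * (psum (bump c) (i + 1) - psum (fold burau w (bump c)) (i + 1))) =
    fdet m (\<lambda>i c. - tpow (-1) * (psum (fold burau w (bump c)) (i + 1) - psum (bump c) (i + 1)) * 1)"
    by (rule fdet_cong) (simp add: algebra_simps)
  also have "\<dots> = (- tpow (-1)) ^ m * fdet m (\<lambda>i c. psum (fold burau w (bump c)) (i + 1) - psum (bump c) (i + 1))"
    by (subst fdet_scale) simp
  finally have eq2: "fdet n T * fdet n ?G =
    (- tpow (-1)) ^ m * fdet m (\<lambda>i c. psum (fold burau w (bump c)) (i + 1) - psum (bump c) (i + 1)) * tpow (int n)"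
    (is "_ = _ * ?D * _") .
  have T: "fdet n T = (\<Prod>i<n. T i i)"
    by (rule fdet_lower_triangular) (auto simp: T_def)
  have lT: "lunit (fdet n T)"
    unfolding T by (intro lunit_prod) (simp add: T_def)
  have lp: "lunit ((- tpow (-1)) ^ k)" for k
    by (induction k) (auto intro: lunit_mult)
  have "assoc_l (fdet N F) (fdet n ?G)"
  proof (rule assoc_l_eqI)
    show "(e * tpow (int n)) * fdet N F = (- tpow (-1)) ^ (L * n) * fdet n ?G"
      using eq1 e(2) by (simp add: mult_ac)
  qed (use lp e(1) in \<open>auto intro: lunit_mult\<close>)
  also have "assoc_l (fdet n ?G) ?D"
  proof (rule assoc_l_eqI)
    show "fdet n T * fdet n ?G = ((- tpow (-1)) ^ m * tpow (int n)) * ?D"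
      using eq2 by (simp add: mult_ac)
  qed (use lp lT in \<open>auto intro: lunit_mult\<close>)
  finally show ?thesis
    unfolding F_def N_def L_def .
qed

text \<open>Expand the determinant of \<open>closure_det\<close> along its last row. All cofactors
  in that row agree, so the expansion is (1 + t + ... + t^(n-1)) \<open>C\<close>; multiplying by 1
  - t gives the stated form.\<close>

theorem closure_alexander_polynomial:
  assumes w: "valid_braid n w" and n: "n = Suc m"
  obtains C where "\<And>D. is_closure_alexander_polynomial n w D \<longleftrightarrow> assoc_l D C"
    "assoc_l ((1 - tpow (int n)) * C)
      ((1 - tpow 1) * fdet m (\<lambda>i c. psum (fold burau w (bump c)) (i + 1) - psum (bump c) (i + 1)))"
proof -
  define N where "N = (length w + 1) * n"
  define C where "C = cofactor (mat N N (\<lambda>(i, j). fox j (closure_relators n w ! i))) (N - 1) 0"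
  have N: "N - 1 < N" "0 < N" "n \<le> N"
    using n by (auto simp: N_def)
  have row: "(\<Sum>j<N. fox j (closure_relators n w ! i)) = 0" if "i < N" for i
    using relval_const[OF w, of i] that by (simp add: relval_def N_def)
  have col: "(\<Sum>i<N. row_weight n w i * fox j (closure_relators n w ! i)) = 0" if "j < N" for j
    using fox_column_relation[OF w, of j] that by (simp add: N_def)
  have D: "is_closure_alexander_polynomial n w D \<longleftrightarrow> assoc_l D C" for D
    unfolding is_closure_alexander_polynomial_def N_def[symmetric] C_def
    by (rule first_elementary_ideal_principal[where v = "row_weight n w"])
      (use N row col in \<open>auto simp: length_closure_relators row_weight_def N_def\<close>)
  define u where "u = (\<lambda>g. if g < n then tpow (int g) else 0)"
  have "fdet N (\<lambda>i g. if i = N - 1 then u g else fox g (closure_relators n w ! i)) =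
    (\<Sum>j<N. u j * cofactor (mat N N (\<lambda>(i, j). fox j (closure_relators n w ! i))) (N - 1) j)"
    by (rule fdet_replace_row) (use N in simp)
  also have "\<dots> = (\<Sum>j<N. u j * C)"
  proof (intro sum.cong refl)
    fix j assume "j \<in> {..<N}"
    then show "u j * cofactor (mat N N (\<lambda>(i, j). fox j (closure_relators n w ! i))) (N - 1) j = u j * C"
      using cofactor_row_const[of N "\<lambda>i j. fox j (closure_relators n w ! i)" "\<lambda>_. 1" "N - 1" j 0] row N
      by (simp add: C_def)
  qed
  also have "\<dots> = (\<Sum>j<N. u j) * C"
    by (simp add: sum_distrib_right)
  also have "(\<Sum>j<N. u j) = (\<Sum>j<n. tpow (int j))"
    unfolding u_def by (rule sum.mono_neutral_cong_right) (use N in auto)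
  finally have "assoc_l ((\<Sum>j<n. tpow (int j)) * C)
      (fdet m (\<lambda>i c. psum (fold burau w (bump c)) (i + 1) - psum (bump c) (i + 1)))"
    using closure_det[OF w n u_def] by (simp add: N_def)
  from assoc_l_mult_left[OF this, of "1 - tpow 1"]
  have "assoc_l (((1 - tpow 1) * (\<Sum>j<n. tpow (int j))) * C)
      ((1 - tpow 1) * fdet m (\<lambda>i c. psum (fold burau w (bump c)) (i + 1) - psum (bump c) (i + 1)))"
    by (simp add: mult.assoc)
  also have "(1 - tpow 1) * (\<Sum>j<n. tpow (int j)) = 1 - tpow (int n)"
  proof -
    have "(1 - tpow 1) * (\<Sum>j<k. tpow (int j)) = 1 - tpow (int k)" for k
      by (induction k) (simp_all add: distrib_left, simp add: algebra_simps tpow_mult)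
    then show ?thesis .
  qed
  finally show thesis
    using that D by blast
qed

section \<open>The Burau action of full twists\<close>

abbreviation descending :: "nat \<Rightarrow> braid_word" where
  "descending n \<equiv> map (\<lambda>i. (i, True)) [1..<n]"

text \<open>The new meridian at a position \<open>j \<le> k\<close> is x_1 x_(j+1) x_1^(-1), so the
  new partial product is x_1 ... x_(j+1) x_1^(-1).\<close>

lemma psum_descending:
  "psum (fold burau (descending (Suc k)) x) j =
     (if j \<le> k then psum x (j + 1) - tpow (int j) * psum x 1 else psum x j)"
proof (induction k arbitrary: j)
  case (Suc k)
  let ?x = "fold burau (descending (Suc k)) x"
  have *: "fold burau (descending (Suc (Suc k))) x = burau (Suc k, True) ?x"
    by simp
  show ?case
  proof (cases "j = Suc k")
    case True
    then show ?thesis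
      unfolding * True psum_burau_True_eq Suc
      by (simp add: algebra_simps tpow_collect)
  next
    case False
    then have step: "psum (burau (Suc k, True) ?x) j = psum ?x j"
      by (intro psum_burau_neq) auto
    show ?thesis
      by (simp only: * step Suc) (use False in auto)
  qed
qed (simp add: psum_Suc)

text \<open>The coordinate y_j of the word x_1 ... x_n x_1 ... x_n; it is meaningful for
  \<open>j \<le> 2 * n\<close> only.\<close>

definition psum_ext :: "nat \<Rightarrow> (nat \<Rightarrow> laurent) \<Rightarrow> nat \<Rightarrow> laurent" where
  "psum_ext n x j = (if j \<le> n then psum x j else psum x n + tpow (int n) * psum x (j - n))"

text \<open>With x_(n+i) = x_i, each factor conjugates and shifts the meridians by one place. After
  \<open>q\<close> factors the partial product is x_1 ... x_(j+q) (x_1 ... x_q)^(-1).\<close>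

lemma psum_descending_power:
  assumes "0 < n" "q \<le> n"
  shows "psum (fold burau (concat (replicate q (descending n))) x) j =
     (if j < n then psum_ext n x (j + q) - tpow (int j) * psum_ext n x q else psum x j)"
  using assms(2)
proof (induction q arbitrary: j)
  case 0
  then show ?case
    by (simp add: psum_ext_def)
next
  case (Suc q)
  let ?x = "fold burau (concat (replicate q (descending n))) x"
  have IH: "psum ?x j =
     (if j < n then psum_ext n x (j + q) - tpow (int j) * psum_ext n x q else psum x j)" for j
    using Suc by simp
  \<comment> \<open>At \<open>j = n\<close> the two branches agree because the total product is
    preserved. The case is needed since the next factor reads position \<open>j + 1\<close>.\<close>
  have n_q: "psum_ext n x (n + q) - tpow (int n) * psum_ext n x q = psum x n"
    using Suc.prems by (simp add: psum_ext_def)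
  have n_q': "psum_ext n x (n + Suc q) = psum x n + tpow (int n) * psum_ext n x (Suc q)"
    using Suc.prems by (simp add: psum_ext_def)
  have IH': "psum ?x j = psum_ext n x (j + q) - tpow (int j) * psum_ext n x q" if "j \<le> n" for j
    using that IH[of j] n_q by (cases "j = n") auto
  obtain m where n: "n = Suc m"
    using \<open>0 < n\<close> by (cases n) auto
  have "concat (replicate (Suc q) (descending n)) = concat (replicate q (descending n)) @ descending n"
    by (simp only: replicate_append_same[symmetric] replicate_Suc concat_append) simp
  then have "fold burau (concat (replicate (Suc q) (descending n))) x = fold burau (descending n) ?x"
    by simp
  then have "psum (fold burau (concat (replicate (Suc q) (descending n))) x) j =
    (if j < n then psum ?x (j + 1) - tpow (int j) * psum ?x 1 else psum ?x j)"
    by (simp only: n psum_descending less_Suc_eq_le)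
  also have "\<dots> = (if j < n then psum_ext n x (j + Suc q) - tpow (int j) * psum_ext n x (Suc q) else psum x j)"
  proof (cases "j < n")
    case True
    then have "psum ?x (j + 1) = psum_ext n x (j + Suc q) - tpow (int j) * (tpow 1 * psum_ext n x q)"
      and "psum ?x 1 = psum_ext n x (Suc q) - tpow 1 * psum_ext n x q"
      using IH'[of "j + 1"] IH'[of 1] n by (simp_all add: tpow_mult_left add.commute)
    then show ?thesis
      by (simp only: True if_True) (simp add: algebra_simps)
  next
    case False
    then show ?thesis
      by (simp only: if_False IH)
  qed
  finally show ?case .
qed

lemma fold_burau_inverse: "fold burau w (fold burau (braid_inverse w) x) = x"
proof (induction w arbitrary: x)
  case (Cons c w)
  obtain i b where c: "c = (i, b)"
    by (cases c)
  have "fold burau (c # w) (fold burau (braid_inverse (c # w)) x) =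
    fold burau w (burau (i, b) (burau (i, \<not> b) (fold burau (braid_inverse w) x)))"
    by (simp add: braid_inverse_def c)
  also have "burau (i, b) (burau (i, \<not> b) y) = y" for y
    by (cases b) (auto simp: fun_eq_iff algebra_simps tpow_collect)
  finally show ?case
    using Cons by simp
qed (simp add: braid_inverse_def)

lemma fold_burau_inverse_power:
  "fold burau (concat (replicate k w)) (fold burau (concat (replicate k (braid_inverse w))) x) = x"
proof (induction k arbitrary: x)
  case (Suc k)
  have *: "concat (replicate (Suc k) (braid_inverse w)) = concat (replicate k (braid_inverse w)) @ braid_inverse w"
    by (simp only: replicate_append_same[symmetric] replicate_Suc concat_append) simp
  show ?case
    unfolding * using Suc by (simp add: fold_burau_inverse)
qed simp

text \<open>A full twist conjugates by x_1 ... x_r, hence maps y_j to t^r y_j + (1 - t^j) y_r.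
  Iteration gives a geometric sum; the factor 1 - t^r on both sides clears its denominator.\<close>

lemma psum_twists_nonneg:
  assumes "0 < r"
  shows "(1 - tpow (int r)) * psum (fold burau (concat (replicate (r * k) (descending r))) x) j =
     (if j < r then (1 - tpow (int r)) * (tpow (int (r * k)) * psum x j) + (1 - tpow (int j)) * (1 - tpow (int (r * k))) * psum x r
      else (1 - tpow (int r)) * psum x j)"
proof (induction k arbitrary: j)
  case (Suc k)
  let ?x = "fold burau (concat (replicate (r * k) (descending r))) x"
  have "concat (replicate (r * Suc k) (descending r)) = concat (replicate (r * k) (descending r)) @ concat (replicate r (descending r))"
    by (simp only: mult_Suc_right replicate_add add.commute[of r] concat_append)
  then have "psum (fold burau (concat (replicate (r * Suc k) (descending r))) x) j =
    (if j < r then psum_ext r ?x (j + r) - tpow (int j) * psum_ext r ?x r else psum ?x j)"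
    using psum_descending_power[OF assms, of r ?x j] by simp
  also have "\<dots> = (if j < r then psum ?x r + tpow (int r) * psum ?x j - tpow (int j) * psum ?x r else psum ?x j)"
    by (auto simp: psum_ext_def)
  finally have "(1 - tpow (int r)) * psum (fold burau (concat (replicate (r * Suc k) (descending r))) x) j =
    (if j < r then (1 - tpow (int j)) * ((1 - tpow (int r)) * psum ?x r) + tpow (int r) * ((1 - tpow (int r)) * psum ?x j)
     else (1 - tpow (int r)) * psum ?x j)"
    by (simp add: algebra_simps)
  then show ?case
    unfolding Suc by (auto simp: algebra_simps tpow_collect)
qed simp

lemma psum_twists:
  assumes "0 < r"
  shows "(1 - tpow (int r)) * psum (fold burau (braid_power (descending r) (int r * s)) x) j =
     (if j < r then (1 - tpow (int r)) * (tpow (int r * s) * psum x j) + (1 - tpow (int j)) * (1 - tpow (int r * s)) * psum x r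
      else (1 - tpow (int r)) * psum x j)"
proof (cases "s \<ge> 0")
  case True
  then show ?thesis
    using psum_twists_nonneg[OF assms, of "nat s" x j] by (simp add: braid_power_def nat_mult_distrib)
next
  case False
  define k where "k = nat (- s)"
  have k: "int r * s = - int (r * k)" "\<not> int r * s \<ge> 0" "nat (- (int r * s)) = r * k"
    using False assms by (simp_all add: k_def mult_less_0_iff not_le nat_mult_distrib flip: mult_minus_right)
  \<comment> \<open>Applying \<open>k = - s\<close> positive twists to \<open>x'\<close> must return
    \<open>x\<close>; this relation is then solved for \<open>x'\<close>.\<close>
  define x' where "x' = fold burau (braid_power (descending r) (int r * s)) x"
  have "fold burau (concat (replicate (r * k) (descending r))) x' = x"
    unfolding x'_def using fold_burau_inverse_power k by (simp add: braid_power_def)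
  then have *: "(1 - tpow (int r)) * psum x j =
     (if j < r then (1 - tpow (int r)) * (tpow (int (r * k)) * psum x' j) + (1 - tpow (int j)) * (1 - tpow (int (r * k))) * psum x' r
      else (1 - tpow (int r)) * psum x' j)" for j
    using psum_twists_nonneg[OF assms, of k x' j] by simp
  have r: "psum x' r = psum x r"
    using *[of r] one_minus_tpow_nonzero[of "int r"] assms by simp
  show ?thesis
  proof (cases "j < r")
    case True
    have solve: "A * z = A * (u * y) + B * (1 - u) * c"
      if "u * v = 1" "A * y = A * (v * z) + B * (1 - v) * c" for A B c u v y z :: laurent
    proof -
      have "A * (u * y) = u * (A * y)"
        by (simp only: mult_ac)
      also have "\<dots> = A * ((u * v) * z) + B * (u - u * v) * c"
        unfolding that(2) by (simp only: algebra_simps mult_1)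
      finally show ?thesis
        unfolding that(1) by (simp add: algebra_simps)
    qed
    show ?thesis
      unfolding x'_def[symmetric] unfolding k(1) using True *[of j] unfolding r
      by (simp only: if_True) (rule solve[OF tpow_cancel(2)])
  next
    case False
    then show ?thesis
      unfolding x'_def[symmetric] using *[of j] by (simp only: if_False)
  qed
qed

text \<open>Makes division by 1 - t^r possible inside the ring. A negative exponent reduces to a
  positive one by 1 - t^a = - t^a (1 - t^(-a)).\<close>

lemma geometric_tpow: "\<exists>S. (1 - tpow (int r)) * S = 1 - tpow (int r * s)"
proof -
  have nonneg: "\<exists>S. (1 - tpow (int r)) * S = 1 - tpow (int r * int k)" for k
  proof (induction k)
    case (Suc k)
    then obtain S where S: "(1 - tpow (int r)) * S = 1 - tpow (int r * int k)"
      by blast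
    have "(1 - tpow (int r)) * (1 + tpow (int r) * S) = 1 - tpow (int r) + tpow (int r) * ((1 - tpow (int r)) * S)"
      by (simp add: algebra_simps)
    also have "\<dots> = 1 - tpow (int r * int (Suc k))"
      unfolding S by (simp add: algebra_simps tpow_collect)
    finally show ?case
      by blast
  qed simp
  show ?thesis
  proof (cases "s \<ge> 0")
    case True
    then show ?thesis
      using nonneg[of "nat s"] by simp
  next
    case False
    then obtain S where S: "(1 - tpow (int r)) * S = 1 - tpow (- (int r * s))"
      using nonneg[of "nat (- s)"] by auto
    have "(1 - tpow (int r)) * (- tpow (int r * s) * S) = - tpow (int r * s) * ((1 - tpow (int r)) * S)"
      by (simp only: mult_ac)
    also have "\<dots> = 1 - tpow (int r * s)"
      unfolding S by (simp add: algebra_simps)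
    finally show ?thesis
      by blast
  qed
qed

section \<open>Determinants of linear functionals\<close>

definition linear_below :: "nat \<Rightarrow> ((nat \<Rightarrow> laurent) \<Rightarrow> laurent) \<Rightarrow> bool" where
  "linear_below n f \<longleftrightarrow> (\<exists>a. \<forall>x. f x = (\<Sum>g<n. a g * x g))"

lemma linear_below_eval: "k < n \<Longrightarrow> linear_below n (\<lambda>x. x k)"
  unfolding linear_below_def
  by (rule exI[of _ "\<lambda>g. if g = k then 1 else 0"]) (simp add: if_distrib[of "\<lambda>x. x * _"] cong: if_cong)

lemma linear_below_add: "linear_below n f \<Longrightarrow> linear_below n g \<Longrightarrow> linear_below n (\<lambda>x. f x + g x)"
  unfolding linear_below_def
proof (elim exE)
  fix a b assume "\<forall>x. f x = (\<Sum>g<n. a g * x g)" "\<forall>x. g x = (\<Sum>g<n. b g * x g)"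
  then show "\<exists>a. \<forall>x. f x + g x = (\<Sum>g<n. a g * x g)"
    by (intro exI[of _ "\<lambda>g. a g + b g"]) (simp add: distrib_right sum.distrib)
qed

lemma linear_below_mult: "linear_below n f \<Longrightarrow> linear_below n (\<lambda>x. c * f x)"
  unfolding linear_below_def
proof (elim exE)
  fix a assume "\<forall>x. f x = (\<Sum>g<n. a g * x g)"
  then show "\<exists>a. \<forall>x. c * f x = (\<Sum>g<n. a g * x g)"
    by (intro exI[of _ "\<lambda>g. c * a g"]) (simp add: sum_distrib_left mult.assoc)
qed

lemma linear_below_diff: "linear_below n f \<Longrightarrow> linear_below n g \<Longrightarrow> linear_below n (\<lambda>x. f x - g x)"
  using linear_below_add[of n f "\<lambda>x. (- 1) * g x"] linear_below_mult[of n g "- 1"] by simp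

text \<open>Here \<open>d\<close> is the coefficient determinant, the same for all test vectors
  \<open>v\<close> and all orderings. Evaluating it on two families of test vectors will compare the
  Burau determinant with the orbit formula.\<close>

lemma fdet_functionals:
  assumes "\<And>i. i < n \<Longrightarrow> linear_below n (f i)"
  obtains d where
    "\<And>\<rho> \<gamma> v. \<rho> permutes {..<n} \<Longrightarrow> \<gamma> permutes {..<n} \<Longrightarrow>
      assoc_l (fdet n (\<lambda>i c. f (\<rho> i) (v c))) (d * fdet n (\<lambda>g c. v c (\<gamma> g)))"
proof -
  from assms have "\<forall>i. \<exists>a. i < n \<longrightarrow> (\<forall>x. f i x = (\<Sum>g<n. a g * x g))"
    unfolding linear_below_def by blast
  then obtain A where A: "f i x = (\<Sum>g<n. A i g * x g)" if "i < n" for i x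
    by metis
  have "assoc_l (fdet n (\<lambda>i c. f (\<rho> i) (v c))) (fdet n A * fdet n (\<lambda>g c. v c (\<gamma> g)))"
    if \<rho>: "\<rho> permutes {..<n}" and \<gamma>: "\<gamma> permutes {..<n}" for \<rho> \<gamma> v
  proof -
    obtain e where e: "e \<in> {1, -1}" "fdet n (\<lambda>i c. f (\<rho> i) (v c)) = e * fdet n (\<lambda>i c. f i (v c))"
      using fdet_permute_rows[OF \<rho>, of "\<lambda>i c. f i (v c)"] by blast
    obtain e' where e': "e' \<in> {1, -1}" "fdet n (\<lambda>g c. v c (\<gamma> g)) = e' * fdet n (\<lambda>g c. v c g)"
      using fdet_permute_rows[OF \<gamma>, of "\<lambda>g c. v c g"] by blast
    have "fdet n (\<lambda>i c. f i (v c)) = fdet n (\<lambda>i c. \<Sum>g<n. A i g * v c g)"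
      by (rule fdet_cong) (simp add: A)
    also have "\<dots> = fdet n A * fdet n (\<lambda>g c. v c g)"
      by (rule fdet_mult)
    finally have "e' * fdet n (\<lambda>i c. f (\<rho> i) (v c)) = e * (fdet n A * fdet n (\<lambda>g c. v c (\<gamma> g)))"
      by (simp add: e e' mult_ac)
    moreover have "lunit e" "lunit e'"
      using e(1) e'(1) by auto
    ultimately show ?thesis
      by (blast intro: assoc_l_eqI)
  qed
  then show thesis
    by (rule that)
qed

section \<open>The reduced Burau matrix of a twisted torus braid\<close>

locale twisted_torus =
  fixes p q r :: nat and s :: int
  assumes coprime: "coprime p q" and q_pos: "0 < q" and q_less: "q < p" and r_gt: "1 < r" and r_less: "r < p"
begin

lemma p_pos: "0 < p"
  using q_less by simp

lemma valid_twisted_torus_braid: "valid_braid p (twisted_torus_braid p q r s)"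
  using r_less unfolding valid_braid_def twisted_torus_braid_def braid_power_def braid_inverse_def
  by auto

text \<open>The normalized coordinates t^(-j) y_j of \<open>bump c\<close> for
  \<open>c < p - 1\<close>, which are periodic modulo \<open>p\<close> because y_p = 0.\<close>

definition \<omega> :: "nat \<Rightarrow> nat \<Rightarrow> laurent" where
  "\<omega> c j = (if j mod p = c + 1 then 1 else 0)"

definition S :: laurent where
  "S = (SOME S. (1 - tpow (int r)) * S = 1 - tpow (int r * s))"

lemma S: "(1 - tpow (int r)) * S = 1 - tpow (int r * s)"
  unfolding S_def using someI_ex[OF geometric_tpow] .

text \<open>The row of y_j divided by t^j. For \<open>j < r\<close> the twist involves the
  coordinate y_r after the torus part; it is replaced by t^r \<open>\<omega> c r\<close>, as the row
  of index \<open>r\<close> permits.\<close>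

definition H :: "nat \<Rightarrow> nat \<Rightarrow> laurent" where
  "H i c = (let j = i + 1 in
     if j < r then tpow (int r * s + int q) * (\<omega> c (j + q) - \<omega> c q) + (tpow (- int j) - 1) * S * tpow (int r) * \<omega> c r - \<omega> c j
     else tpow (int q) * (\<omega> c (j + q) - \<omega> c q) - \<omega> c j)"

lemma psum_bump_\<omega>: "c < p - 1 \<Longrightarrow> j \<le> p \<Longrightarrow> psum (bump c) j = tpow (int j) * \<omega> c j"
  by (cases "j = p") (auto simp: psum_bump \<omega>_def)

lemma psum_ext_bump: "c < p - 1 \<Longrightarrow> j \<le> 2 * p \<Longrightarrow> psum_ext p (bump c) j = tpow (int j) * \<omega> c j"
  unfolding psum_ext_def
  by (auto simp: psum_bump_\<omega> tpow_mult_left \<omega>_def mod_if[of p] le_mod_geq)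

lemma psum_twisted_torus:
  assumes "c < p - 1" "j < p"
  defines "z \<equiv> \<lambda>j. tpow (int (j + q)) * (\<omega> c (j + q) - \<omega> c q)"
  shows "psum (fold burau (twisted_torus_braid p q r s) (bump c)) j =
    (if j < r then tpow (int r * s) * z j + (1 - tpow (int j)) * S * z r else z j)"
proof -
  define x where "x = fold burau (concat (replicate q (descending p))) (bump c)"
  have z: "psum x j = z j" if "j < p" for j
  proof -
    have "psum x j = psum_ext p (bump c) (j + q) - tpow (int j) * psum_ext p (bump c) q"
      unfolding x_def using psum_descending_power[OF p_pos, of q "bump c" j] that q_less by simp
    also have "\<dots> = z j"
      using assms(1) that q_less by (simp add: psum_ext_bump z_def algebra_simps tpow_collect)
    finally show ?thesis .
  qed
  have "fold burau (twisted_torus_braid p q r s) (bump c) = fold burau (braid_power (descending r) (int r * s)) x"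
    by (simp add: twisted_torus_braid_def x_def braid_power_def)
  then have "(1 - tpow (int r)) * psum (fold burau (twisted_torus_braid p q r s) (bump c)) j =
    (if j < r then (1 - tpow (int r)) * (tpow (int r * s) * z j) + (1 - tpow (int j)) * ((1 - tpow (int r)) * S) * z r
      else (1 - tpow (int r)) * z j)"
    unfolding S using psum_twists[of r s x j] r_gt r_less assms(2) by (simp add: z)
  also have "\<dots> = (1 - tpow (int r)) * (if j < r then tpow (int r * s) * z j + (1 - tpow (int j)) * S * z r else z j)"
    by (simp add: algebra_simps)
  finally show ?thesis
    using one_minus_tpow_nonzero[of "int r"] r_gt by simp
qed

lemma fdet_twisted_torus:
  "assoc_l (fdet (p - 1) (\<lambda>i c. psum (fold burau (twisted_torus_braid p q r s) (bump c)) (i + 1) - psum (bump c) (i + 1)))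
    (fdet (p - 1) H)"
proof -
  define u where "u = (\<lambda>j. if j < r then (tpow (- int j) - 1) * S * tpow (int r) else 0)"
  \<comment> \<open>Unitriangular row operations, adding multiples of row \<open>r - 1\<close>, that
    undo the replacement of y_r made in \<open>H\<close>.\<close>
  define T where "T = (\<lambda>i k :: nat. if k = i then 1 else if k = r - 1 then u (i + 1) else 0)"
  let ?G = "\<lambda>i c. psum (fold burau (twisted_torus_braid p q r s) (bump c)) (i + 1) - psum (bump c) (i + 1)"
  have T: "fdet (p - 1) T = 1"
    by (subst fdet_upper_triangular) (auto simp: T_def u_def)
  have G: "?G i c = tpow (int (i + 1)) * (\<Sum>k<p - 1. T i k * H k c)" if ic: "i < p - 1" "c < p - 1" for i c
  proof -
    have Hr: "H (r - 1) c = tpow (int q) * (\<omega> c (r + q) - \<omega> c q) - \<omega> c r"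
      using r_gt by (simp add: H_def)
    have "(\<Sum>k<p - 1. T i k * H k c) = (\<Sum>k<p - 1. (if k = i then H k c else 0) + (if k = r - 1 then u (i + 1) * H k c else 0))"
      using r_gt by (intro sum.cong) (auto simp: T_def u_def)
    also have "\<dots> = H i c + u (i + 1) * H (r - 1) c"
      using ic r_gt r_less by (simp add: sum.distrib)
    finally have sum: "(\<Sum>k<p - 1. T i k * H k c) = H i c + u (i + 1) * H (r - 1) c" .
    define j where "j = i + 1"
    have j: "j < p" "i + 1 = j"
      using ic by (auto simp: j_def)
    have Hi: "H i c = (if j < r then tpow (int r * s + int q) * (\<omega> c (j + q) - \<omega> c q) + (tpow (- int j) - 1) * S * tpow (int r) * \<omega> c r - \<omega> c j
       else tpow (int q) * (\<omega> c (j + q) - \<omega> c q) - \<omega> c j)"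
      unfolding H_def Let_def j(2) ..
    show ?thesis
    proof (cases "j < r")
      case True
      have eq: "(\<Sum>k<p - 1. T i k * H k c) = tpow (int r * s + int q) * (\<omega> c (j + q) - \<omega> c q) +
        (tpow (- int j) - 1) * S * tpow (int r) * (tpow (int q) * (\<omega> c (r + q) - \<omega> c q)) - \<omega> c j"
        unfolding sum Hr using True by (simp add: Hi j(2)[simplified] u_def algebra_simps)
      have "tpow (int j) * (\<Sum>k<p - 1. T i k * H k c) =
        tpow (int r * s) * (tpow (int (j + q)) * (\<omega> c (j + q) - \<omega> c q)) +
        (tpow (int j) * tpow (- int j) - tpow (int j)) * S * (tpow (int (r + q)) * (\<omega> c (r + q) - \<omega> c q)) - tpow (int j) * \<omega> c j"
        unfolding eq tpow_add of_nat_add by (simp only: algebra_simps mult_1 mult_1_right)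
      then show ?thesis
        unfolding j(2) using psum_twisted_torus[OF ic(2) j(1)] psum_bump_\<omega>[OF ic(2), of j] True j(1) by simp
    next
      case False
      then have eq: "(\<Sum>k<p - 1. T i k * H k c) = tpow (int q) * (\<omega> c (j + q) - \<omega> c q) - \<omega> c j"
        unfolding sum by (simp add: Hi j(2)[simplified] u_def)
      show ?thesis
        unfolding j(2) eq using psum_twisted_torus[OF ic(2) j(1)] psum_bump_\<omega>[OF ic(2), of j] False j(1)
        by (simp add: algebra_simps tpow_collect)
    qed
  qed
  have "fdet (p - 1) ?G = fdet (p - 1) (\<lambda>i c. tpow (int (i + 1)) * (\<Sum>k<p - 1. T i k * H k c) * 1)"
    by (rule fdet_cong) (simp only: G mult_1_right)
  also have "\<dots> = (\<Prod>i<p - 1. tpow (int (i + 1))) * fdet (p - 1) H"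
    by (subst fdet_scale) (simp only: fdet_mult T prod.neutral_const mult_1 mult_1_right)
  finally show ?thesis
    using lunit_prod[of "{..<p - 1}" "\<lambda>i. tpow (int (i + 1))"] unfolding assoc_l_def by auto
qed

section \<open>The system with two adjoined unknowns\<close>

text \<open>
  The unknowns \<open>x 0, \<dots>, x (p - 1)\<close> are the entries of the kernel vector, shifted by the value that
  makes translation by \<open>q\<close> homogeneous outside \<open>{0..<r}\<close>; the shift is \<open>x 0\<close>. The unknown \<open>x p\<close>
  is the contribution of the full twist. The last equation and the one with index 0 define the two
  auxiliary unknowns, whose elimination yields the factor \<open>(1 - t^q) (1 - t^r)\<close>.
\<close>

definition krow :: "nat \<Rightarrow> (nat \<Rightarrow> laurent) \<Rightarrow> laurent" where
  "krow j x = (if j = p then (1 - tpow (int r)) * x p - tpow (int r) * x r + tpow (int r) * x 0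
     else if j < r then tpow (int r * s + int q) * x ((j + q) mod p) - x j +
         (1 - tpow (int r * s)) * (x 0 + (tpow (- int j) - 1) * x p)
     else tpow (int q) * x ((j + q) mod p) - x j)"

lemma linear_below_krow: "j < p + 1 \<Longrightarrow> linear_below (p + 1) (krow j)"
proof -
  assume "j < p + 1"
  moreover have "(j + q) mod p < p + 1"
    using mod_less_divisor[OF p_pos, of "j + q"] by simp
  ultimately show ?thesis
    using r_less unfolding krow_def[abs_def]
    by (cases "j = p"; cases "j < r")
      (auto intro!: linear_below_add linear_below_diff linear_below_mult linear_below_eval)
qed

text \<open>The vectors \<open>\<omega> c\<close> are extended to the two auxiliary unknowns so that
  equations 0 and \<open>p\<close> hold. Scaling by D = (1 - t^q) (1 - t^r) keeps the extension in
  the ring. The powers D^(p-1) cancel, and the two auxiliary equations contribute one further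
  D.\<close>

lemma fdet_krow_eliminate:
  assumes d: "\<And>\<rho> \<gamma> v. \<rho> permutes {..<p + 1} \<Longrightarrow> \<gamma> permutes {..<p + 1} \<Longrightarrow>
      assoc_l (fdet (p + 1) (\<lambda>i c. krow (\<rho> i) (v c))) (d * fdet (p + 1) (\<lambda>g c. v c (\<gamma> g)))"
  shows "assoc_l d ((1 - tpow (int q)) * (1 - tpow (int r)) * fdet (p - 1) H)"
proof -
  define n where "n = p - 1"
  have n: "p + 1 = n + 2" "p = Suc n"
    using p_pos by (auto simp: n_def)
  \<comment> \<open>The order 1, ..., p - 1, 0, p, used for equations and unknowns alike: the
    auxiliary ones come last.\<close>
  define \<rho> where "\<rho> = (\<lambda>i. if i < n then i + 1 else if i = n then 0 else i)"
  have \<rho>: "\<rho> permutes {..<p + 1}"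
  proof (rule bij_imp_permutes)
    have "inj_on \<rho> {..<p + 1}"
      by (auto simp: inj_on_def \<rho>_def n split: if_splits)
    moreover have "\<rho> ` {..<p + 1} \<subseteq> {..<p + 1}"
      by (auto simp: \<rho>_def n)
    ultimately show "bij_betw \<rho> {..<p + 1} {..<p + 1}"
      by (simp add: bij_betw_def endo_inj_surj)
  qed (simp add: \<rho>_def n)
  define D where "D = (1 - tpow (int q)) * (1 - tpow (int r))"
  \<comment> \<open>The shift \<open>\<kappa>\<close> is forced by equation 0 and the twist value
    \<open>\<mu>\<close> by equation \<open>p\<close>.\<close>
  define \<kappa> where "\<kappa> = (\<lambda>c. tpow (int q) * (1 - tpow (int r)) * \<omega> c q)"
  define \<mu> where "\<mu> = (\<lambda>c. tpow (int r) * (1 - tpow (int q)) * \<omega> c r)"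
  define v where "v = (\<lambda>c j. if c < n then (if j = p then \<mu> c else D * \<omega> c j + \<kappa> c)
     else if c = n then (if j = p then 0 else 1) else (if j = p then 1 else 0))"
  have \<kappa>: "(1 - tpow (int q)) * \<kappa> c = tpow (int q) * (D * \<omega> c q)" for c
    by (simp add: \<kappa>_def D_def mult_ac)
  have \<mu>: "(1 - tpow (int r)) * \<mu> c = tpow (int r) * (D * \<omega> c r)" for c
    by (simp add: \<mu>_def D_def mult_ac)
  have \<omega>0: "\<omega> c 0 = 0" and \<omega>mod: "\<omega> c (j mod p) = \<omega> c j" for c j
    by (simp_all add: \<omega>_def)
  have v_lt: "v c j = D * \<omega> c j + \<kappa> c" if "j < p" "c < n" for c j
    using that by (simp add: v_def)
  have v_mod: "v c (j mod p) = D * \<omega> c j + \<kappa> c" if "c < n" for c j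
    using v_lt[OF mod_less_divisor[OF p_pos] that] by (simp add: \<omega>mod)
  have v_p: "v c p = \<mu> c" if "c < n" for c
    using that by (simp add: v_def)
  have row_H: "krow (i + 1) (v c) = D * H i c" if "i < n" "c < n" for i c
  proof (cases "i + 1 < r")
    case True
    define j where "j = i + 1"
    have j: "j < p" "j < r" "i + 1 = j"
      using True r_less by (auto simp: j_def)
    have "krow j (v c) = tpow (int r * s + int q) * (D * \<omega> c (j + q) + \<kappa> c) - (D * \<omega> c j + \<kappa> c)
      + (1 - tpow (int r * s)) * (\<kappa> c + (tpow (- int j) - 1) * \<mu> c)"
      using j that by (simp add: krow_def v_mod v_lt \<omega>mod v_p p_pos \<omega>0)
    also have "\<dots> = tpow (int r * s + int q) * (D * \<omega> c (j + q)) - D * \<omega> c j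
      - tpow (int r * s) * ((1 - tpow (int q)) * \<kappa> c) + (tpow (- int j) - 1) * S * ((1 - tpow (int r)) * \<mu> c)"
      unfolding S[symmetric] tpow_add
      using arg_cong[OF S, of "\<lambda>y. y * \<kappa> c"] by (simp add: algebra_simps)
    also have "\<dots> = D * H i c"
      unfolding \<kappa> \<mu> using j by (simp add: H_def tpow_add algebra_simps)
    finally show ?thesis
      by (simp add: j_def)
  next
    case False
    define j where "j = i + 1"
    have j: "j < p" "\<not> j < r" "i + 1 = j"
      using False that n by (auto simp: j_def)
    have "krow j (v c) = tpow (int q) * (D * \<omega> c (j + q) + \<kappa> c) - (D * \<omega> c j + \<kappa> c)"
      using j that by (simp add: krow_def v_mod v_lt \<omega>mod)
    also have "\<dots> = tpow (int q) * (D * \<omega> c (j + q)) - D * \<omega> c j - (1 - tpow (int q)) * \<kappa> c"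
      by (simp add: algebra_simps)
    also have "\<dots> = D * H i c"
      unfolding \<kappa> using j by (simp add: H_def algebra_simps)
    finally show ?thesis
      by (simp add: j_def)
  qed
  have row_0: "krow 0 (v c) = 0" if "c < n" for c
  proof -
    have "krow 0 (v c) = tpow (int r * s) * tpow (int q) * (D * \<omega> c q + \<kappa> c) - \<kappa> c + (1 - tpow (int r * s)) * \<kappa> c"
      using that r_gt p_pos by (simp add: krow_def v_mod v_lt \<omega>mod \<omega>0 tpow_add)
    also have "\<dots> = tpow (int r * s) * (tpow (int q) * (D * \<omega> c q) - (1 - tpow (int q)) * \<kappa> c)"
      by (simp add: algebra_simps)
    finally show ?thesis
      unfolding \<kappa> by simp
  qed
  have row_p: "krow p (v c) = 0" if "c < n" for c
    using that r_less p_pos \<mu>[of c] by (simp add: krow_def v_p v_lt \<omega>0 algebra_simps)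
  have last: "krow 0 (v n) = tpow (int r * s) * (tpow (int q) - 1)" "krow p (v n) = 0"
    "krow 0 (v (n + 1)) = 0" "krow p (v (n + 1)) = 1 - tpow (int r)"
    using r_gt r_less p_pos q_less
    by (auto simp: krow_def v_def tpow_add algebra_simps)
  have "fdet (n + 2) (\<lambda>i c. krow (\<rho> i) (v c)) =
    fdet n (\<lambda>i c. krow (\<rho> i) (v c)) * fdet 2 (\<lambda>i c. krow (\<rho> (n + i)) (v (n + c)))"
  proof (rule fdet_four_block')
    show "krow (\<rho> (n + i)) (v c) = 0" if "i < 2" "c < n" for i c
      using that row_0[of c] row_p[of c] n by (cases i) (auto simp: \<rho>_def)
  qed
  also have "fdet n (\<lambda>i c. krow (\<rho> i) (v c)) = fdet n (\<lambda>i c. D * H i c * 1)"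
    by (rule fdet_cong) (use row_H in \<open>simp add: \<rho>_def\<close>)
  also have "\<dots> = D ^ n * fdet n H"
    by (subst fdet_scale) simp
  also have "fdet 2 (\<lambda>i c. krow (\<rho> (n + i)) (v (n + c))) = - tpow (int r * s) * D"
  proof -
    have "\<rho> (n + 0) = 0" "\<rho> (n + 1) = p"
      by (simp_all add: \<rho>_def n)
    then have "fdet 2 (\<lambda>i c. krow (\<rho> (n + i)) (v (n + c))) =
      tpow (int r * s) * (tpow (int q) - 1) * (1 - tpow (int r))"
      unfolding fdet_2 by (simp only: add_0_right last) simp
    then show ?thesis
      by (simp add: D_def algebra_simps)
  qed
  finally have det1: "fdet (p + 1) (\<lambda>i c. krow (\<rho> i) (v c)) = - tpow (int r * s) * (D ^ n * (D * fdet n H))"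
    by (simp add: n mult_ac)
  \<comment> \<open>Factors out the common shift: \<open>B\<close> adds coordinate \<open>n\<close>,
    the value at position 0, to the first \<open>n\<close> coordinates, and the remaining matrix
    \<open>x\<close> is triangular.\<close>
  define B where "B = (\<lambda>g k :: nat. if g = k \<or> (g < n \<and> k = n) then 1 else 0 :: laurent)"
  define x where "x = (\<lambda>g c :: nat. if c < n then (if g < n then (if g = c then D else 0) else if g = n then \<kappa> c else \<mu> c)
     else if g = c then 1 else 0)"
  have "fdet (n + 2) (\<lambda>g c. v c (\<rho> g)) = fdet (n + 2) (\<lambda>g c. \<Sum>k<n + 2. B g k * x k c)"
  proof (rule fdet_cong)
    fix g c assume gc: "g < n + 2" "c < n + 2"
    have "(\<Sum>k<n + 2. B g k * x k c) = (\<Sum>k<n + 2. (if k = g then x k c else 0) + (if k = n then (if g < n then x k c else 0) else 0))"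
      by (intro sum.cong) (auto simp: B_def)
    also have "\<dots> = x g c + (if g < n then x n c else 0)"
      using gc by (simp add: sum.distrib)
    also have "\<dots> = v c (\<rho> g)"
    proof -
      have "\<omega> c (Suc g) = (if g = c then 1 else 0)" if "g < n"
      proof -
        have "Suc g < p"
          using that n by simp
        then show ?thesis
          by (simp add: \<omega>_def)
      qed
      then show ?thesis
        using gc n \<omega>0[of c] by (auto simp: x_def v_def \<rho>_def less_Suc_eq)
    qed
    finally show "v c (\<rho> g) = (\<Sum>k<n + 2. B g k * x k c)" ..
  qed
  also have "\<dots> = fdet (n + 2) B * fdet (n + 2) x"
    by (rule fdet_mult)
  also have "fdet (n + 2) B = 1"
    by (subst fdet_upper_triangular) (auto simp: B_def)
  also have "fdet (n + 2) x = (\<Prod>i<n + 2. x i i)"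
    by (rule fdet_lower_triangular) (auto simp: x_def)
  also have "\<dots> = D ^ n"
    by (simp add: x_def numeral_2_eq_2)
  finally have det2: "fdet (p + 1) (\<lambda>g c. v c (\<rho> g)) = D ^ n"
    by (simp add: n)
  obtain e where e: "lunit e" "- tpow (int r * s) * (D ^ n * (D * fdet n H)) = e * (d * D ^ n)"
    using d[OF \<rho> \<rho>, of v] unfolding det1 det2 assoc_l_def by blast
  have "D \<noteq> 0"
    using one_minus_tpow_nonzero q_pos r_gt by (simp add: D_def)
  then have "- tpow (int r * s) * (D * fdet n H) = e * d"
  proof -
    have "D ^ n * (- tpow (int r * s) * (D * fdet n H)) = D ^ n * (e * d)"
      using e(2) by (simp only: mult_ac)
    then show ?thesis
      using \<open>D \<noteq> 0\<close> by (simp only: mult_cancel_left power_eq_0_iff) simp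
  qed
  then have "assoc_l d (D * fdet n H)"
    using e(1) by (intro assoc_l_eqI[of e d "- tpow (int r * s)"]) auto
  then show ?thesis
    by (simp add: D_def n_def)
qed

section \<open>The combinatorial data\<close>

text \<open>The time at which the orbit 0, q, 2q, ... modulo \<open>p\<close> reaches position
  \<open>j\<close>.\<close>

definition lg :: "nat \<Rightarrow> nat" where
  "lg j = j * nat (modular_inverse (int p) (int q)) mod p"

lemma lg_less: "lg j < p"
  using p_pos by (simp add: lg_def)

lemma inverse_q: "nat (modular_inverse (int p) (int q)) * q mod p = 1"
proof -
  let ?a = "modular_inverse (int p) (int q)"
  have "?a \<ge> 0"
    using p_pos by (simp add: modular_inverse_int_nonneg)
  have "[?a * int q = 1] (mod int p)"
    using coprime by (intro cong_modular_inverse2) (simp add: coprime_commute)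
  moreover have "1 mod int p = 1"
    using r_gt r_less by (intro mod_pos_pos_trivial) auto
  ultimately have "int (nat ?a * q mod p) = 1"
    using \<open>?a \<ge> 0\<close> by (simp add: cong_def zmod_int)
  then show ?thesis
    by linarith
qed

lemma lg_mult: "lg j * q mod p = j mod p"
proof -
  have "lg j * q mod p = j * (nat (modular_inverse (int p) (int q)) * q mod p) mod p"
    by (simp add: lg_def mod_mult_left_eq mod_mult_right_eq mult.assoc)
  then show ?thesis
    by (simp add: inverse_q)
qed

lemma mult_lg: "lg (l * q mod p) = l mod p"
proof -
  have "lg (l * q mod p) = l * (nat (modular_inverse (int p) (int q)) * q mod p) mod p"
    by (simp add: lg_def mod_mult_left_eq mod_mult_right_eq mult_ac)
  then show ?thesis
    by (simp add: inverse_q)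
qed

lemma lg_0: "lg 0 = 0"
  by (simp add: lg_def)

lemma tt_res_of_nat: "tt_res p q (int n) = int (lg n)"
  using p_pos by (simp add: tt_res_def lg_def zmod_int modular_inverse_int_nonneg)

lemma tt_res_minus: "n \<le> p \<Longrightarrow> tt_res p q (- int n) = int (lg (p - n))"
proof -
  assume "n \<le> p"
  then have "tt_res p q (int (p - n)) = tt_res p q (- int n)"
  proof -
    have "int (p - n) * modular_inverse (int p) (int q) =
      - int n * modular_inverse (int p) (int q) + modular_inverse (int p) (int q) * int p"
      using \<open>n \<le> p\<close> by (simp add: of_nat_diff algebra_simps)
    then show ?thesis
      by (simp only: tt_res_def mod_mult_self1)
  qed
  then show ?thesis
    by (simp add: tt_res_of_nat)
qed

section \<open>Times at which the orbit meets {0..<r} or wraps around\<close>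

definition QN :: "nat set" where "QN = {l. l < p \<and> l * q mod p < r}"

text \<open>The times at which the next step by \<open>q\<close> passes \<open>p\<close>.\<close>

definition RN :: "nat set" where "RN = {l. l < p \<and> p - q \<le> l * q mod p}"

lemma finite_QN: "finite QN" and finite_RN: "finite RN"
  by (simp_all add: QN_def RN_def)

lemma QN_lg: "QN = lg ` {..<r}"
proof (intro equalityI subsetI)
  fix l assume "l \<in> QN"
  then show "l \<in> lg ` {..<r}"
    using mult_lg[of l] by (intro image_eqI[of _ _ "l * q mod p"]) (auto simp: QN_def)
qed (use r_less in \<open>auto simp: QN_def lg_less lg_mult\<close>)

lemma card_QN: "card QN = r"
proof -
  have "inj_on lg {..<r}"
    using lg_mult r_less by (intro inj_onI) (metis lessThan_iff mod_less order.strict_trans)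
  then show ?thesis
    by (simp add: QN_lg card_image)
qed

lemma tt_Qset_eq: "tt_Qset p q r = int ` QN"
  unfolding tt_Qset_def QN_lg by (auto simp: tt_res_of_nat)

lemma RN_lg: "RN = (\<lambda>n. lg (p - n)) ` {1..q}"
proof (intro equalityI subsetI)
  fix l assume l: "l \<in> RN"
  define n where "n = p - l * q mod p"
  have "l * q mod p < p" "p - q \<le> l * q mod p"
    using l p_pos by (auto simp: RN_def)
  then have "n \<in> {1..q}" "p - n = l * q mod p"
    using q_less unfolding n_def atLeastAtMost_iff by linarith+
  then show "l \<in> (\<lambda>n. lg (p - n)) ` {1..q}"
    using mult_lg[of l] l by (intro image_eqI[of _ _ n]) (auto simp: RN_def)
next
  fix l assume "l \<in> (\<lambda>n. lg (p - n)) ` {1..q}"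
  then obtain n where "1 \<le> n" "n \<le> q" "l = lg (p - n)"
    by auto
  then show "l \<in> RN"
    using q_less by (auto simp: RN_def lg_less lg_mult)
qed

lemma tt_Rset_eq: "tt_Rset p q = int ` RN"
proof -
  have "tt_Rset p q = (\<lambda>n. tt_res p q (- int n)) ` {1..q}"
    unfolding tt_Rset_def by auto
  also have "\<dots> = (\<lambda>n. int (lg (p - n))) ` {1..q}"
    using q_less by (intro image_cong refl) (simp add: tt_res_minus)
  finally show ?thesis
    by (simp add: RN_lg image_image)
qed

definition qn :: "nat \<Rightarrow> nat" where "qn i = sorted_list_of_set QN ! i"

lemma tt_Q_eq: "i < r \<Longrightarrow> tt_Q p q r i = int (qn i)"
proof -
  have "sorted_list_of_set (int ` QN) = map int (sorted_list_of_set QN)"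
  proof (rule sorted_distinct_set_unique)
    show "sorted (map int (sorted_list_of_set QN))"
      by (simp add: sorted_map)
  qed (use finite_QN in \<open>auto simp: distinct_map\<close>)
  then show "i < r \<Longrightarrow> ?thesis"
    by (simp add: tt_Q_def qn_def tt_Qset_eq card_QN)
qed

lemma qn_less_iff: "i < r \<Longrightarrow> j < r \<Longrightarrow> qn i < qn j \<longleftrightarrow> i < j"
proof -
  have "qn i < qn j" if "i < j" "j < r" for i j
    using sorted_wrt_nth_less[OF strict_sorted_list_of_set, of i j QN] that by (simp add: qn_def card_QN)
  then show "i < r \<Longrightarrow> j < r \<Longrightarrow> ?thesis"
    by (metis linorder_neqE_nat order.asym)
qed

lemma qn_image: "qn ` {..<r} = QN"
proof -
  have "QN = set (sorted_list_of_set QN)"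
    using finite_QN by simp
  also have "\<dots> = qn ` {..<r}"
    unfolding set_conv_nth by (auto simp: qn_def card_QN)
  finally show ?thesis ..
qed

lemma inj_on_qn: "inj_on qn {..<r}"
  using qn_less_iff by (intro inj_onI) (metis lessThan_iff linorder_neqE_nat order.irrefl)

lemma qn_0: "qn 0 = 0"
proof -
  have "0 \<in> qn ` {..<r}"
    unfolding qn_image using p_pos r_gt by (simp add: QN_def)
  then obtain i where "i < r" "qn i = 0"
    by auto
  then show ?thesis
    using qn_less_iff[of 0 i] by (cases "i = 0") auto
qed

definition Qp :: nat where "Qp = lg r"

lemma Qp: "Qp * q mod p = r" "Qp < p" "Qp \<notin> QN" "0 < Qp"
proof -
  show *: "Qp * q mod p = r"
    using r_less by (simp add: Qp_def lg_mult)
  show "Qp < p"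
    by (simp add: Qp_def lg_less)
  show "Qp \<notin> QN"
    using * by (simp add: QN_def)
  show "0 < Qp"
    using * r_gt by (cases "Qp = 0") auto
qed

lemma tt_Q'_eq: "tt_Q' p q r = int Qp"
  by (simp add: tt_Q'_def Qp_def tt_res_of_nat)

text \<open>Time 0 is left out: equation 0 reads t^(rs) (t^q x_q - x_0), a unit times an unperturbed
  equation.\<close>

definition W :: "nat set" where "W = QN - {0}"

definition cnt :: "nat \<Rightarrow> nat" where "cnt l = card {h \<in> W. h < l}"

lemma finite_W: "finite W"
  by (simp add: W_def finite_QN)

lemma W_below_qn:
  assumes "i < r"
  shows "{h \<in> W. h < qn i} = qn ` {1..<i}"
proof (intro equalityI subsetI)
  fix h assume "h \<in> {h \<in> W. h < qn i}"
  then have h: "h \<in> qn ` {..<r}" "h \<noteq> 0" "h < qn i"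
    by (auto simp: W_def qn_image)
  then obtain j where j: "j < r" "h = qn j"
    by auto
  moreover have "j \<noteq> 0"
    using h(2) j(2) qn_0 by metis
  ultimately show "h \<in> qn ` {1..<i}"
    using h qn_less_iff[OF j(1) assms] by (intro image_eqI[of _ _ j]) auto
next
  fix h assume "h \<in> qn ` {1..<i}"
  then obtain j where j: "1 \<le> j" "j < i" "h = qn j"
    by auto
  then have "0 < h"
    using qn_less_iff[of 0 j] assms by (simp add: qn_0)
  moreover have "h \<in> QN"
    using qn_image j assms by auto
  ultimately show "h \<in> {h \<in> W. h < qn i}"
    using j qn_less_iff[of j i] assms by (simp add: W_def)
qed

lemma cnt_qn: "1 \<le> i \<Longrightarrow> i < r \<Longrightarrow> cnt (qn i) = i - 1"
  unfolding cnt_def by (subst W_below_qn) (auto intro!: card_image[THEN trans] inj_on_subset[OF inj_on_qn])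

lemma W_below:
  assumes "k < r" "qn k < l" "k + 1 < r \<longrightarrow> l \<le> qn (k + 1)"
  shows "{h \<in> W. h < l} = qn ` {1..k}"
proof (intro equalityI subsetI)
  fix h assume "h \<in> {h \<in> W. h < l}"
  then have h: "h \<in> qn ` {..<r}" "h \<noteq> 0" "h < l"
    by (auto simp: W_def qn_image)
  then obtain j where j: "j < r" "h = qn j"
    by auto
  have "j \<noteq> 0"
    using h(2) j(2) qn_0 by metis
  moreover have "j \<le> k"
  proof (rule ccontr)
    assume "\<not> j \<le> k"
    then have "k + 1 \<le> j" "k + 1 < r"
      using j by auto
    then have "qn (k + 1) \<le> qn j"
      using qn_less_iff[of "k + 1" j] j by (cases "k + 1 = j") auto
    then show False
      using assms \<open>k + 1 < r\<close> h j by simp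
  qed
  ultimately show "h \<in> qn ` {1..k}"
    using j by (intro image_eqI[of _ _ j]) auto
next
  fix h assume "h \<in> qn ` {1..k}"
  then obtain j where j: "1 \<le> j" "j \<le> k" "h = qn j"
    by auto
  then have "0 < h"
    using qn_less_iff[of 0 j] assms by (simp add: qn_0)
  moreover have "h \<in> QN"
    using qn_image j assms by auto
  moreover have "qn j \<le> qn k"
    using qn_less_iff[of k j] assms j by (metis le_less_trans linorder_not_less)
  ultimately show "h \<in> {h \<in> W. h < l}"
    using j assms by (simp add: W_def)
qed

text \<open>Turns sums over perturbation times into the indexed sums of the formula. Since
  \<open>qn 0 = 0\<close> is not in \<open>W\<close>, the time \<open>qn i\<close> has
  \<open>i - 1\<close> predecessors there, whence the exponents (i - 1) r s. For
  \<open>k = r - 1\<close> there is no upper bound on \<open>l\<close>, which covers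
  \<open>l = p\<close>.\<close>

lemma sum_W_below:
  assumes "k < r" "qn k < l" "k + 1 < r \<longrightarrow> l \<le> qn (k + 1)"
  shows "(\<Sum>h \<in> {h \<in> W. h < l}. F h (cnt h)) = (\<Sum>i = 1..k. F (qn i) (i - 1))" and "cnt l = k"
proof -
  have inj: "inj_on qn {1..k}"
    using assms(1) by (intro inj_on_subset[OF inj_on_qn]) auto
  show "(\<Sum>h \<in> {h \<in> W. h < l}. F h (cnt h)) = (\<Sum>i = 1..k. F (qn i) (i - 1))"
    unfolding W_below[OF assms] sum.reindex[OF inj] o_def
    by (intro sum.cong refl) (use assms(1) in \<open>simp add: cnt_qn\<close>)
  show "cnt l = k"
    unfolding cnt_def W_below[OF assms] using inj by (simp add: card_image)
qed

lemma qn_last: "qn (r - 1) < p" "r - 1 < r"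
proof -
  show "r - 1 < r"
    using r_gt by simp
  then have "qn (r - 1) \<in> qn ` {..<r}"
    by blast
  then show "qn (r - 1) < p"
    unfolding qn_image by (simp add: QN_def)
qed

lemma tt_m:
  shows tt_m_less: "tt_m p q r < r"
    and qn_tt_m: "qn (tt_m p q r) < Qp"
    and Qp_less: "tt_m p q r + 1 < r \<Longrightarrow> Qp < qn (tt_m p q r + 1)"
proof -
  let ?P = "\<lambda>i. i < r \<and> tt_Q p q r i < tt_Q' p q r \<and> (i + 1 < r \<longrightarrow> tt_Q' p q r < tt_Q p q r (i + 1))"
  have P_iff: "?P i \<longleftrightarrow> i < r \<and> qn i < Qp \<and> (i + 1 < r \<longrightarrow> Qp < qn (i + 1))" for i
    by (auto simp: tt_Q_eq tt_Q'_eq)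
  \<comment> \<open>The index sought is the largest element of \<open>A\<close>; the strict bound
    after it uses that \<open>Qp\<close> is not in \<open>QN\<close>.\<close>
  define A where "A = {i. i < r \<and> qn i < Qp}"
  have "0 \<in> A" "finite A"
    using qn_0 Qp(4) r_gt by (auto simp: A_def)
  define m where "m = Max A"
  have m: "m \<in> A"
    unfolding m_def using \<open>0 \<in> A\<close> \<open>finite A\<close> by (intro Max_in) auto
  have "Qp < qn (m + 1)" if "m + 1 < r"
  proof -
    have "m + 1 \<notin> A"
      using Max_ge[OF \<open>finite A\<close>, of "m + 1"] unfolding m_def[symmetric] by auto
    then have "Qp \<le> qn (m + 1)"
      using that by (simp add: A_def)
    moreover have "qn (m + 1) \<in> QN"
      using that qn_image by blast
    ultimately show ?thesis
      using Qp(3) by (metis le_neq_implies_less)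
  qed
  then have Pm: "?P m"
    using m unfolding P_iff by (auto simp: A_def)
  have unique: "i = m" if "?P i" for i
  proof (rule ccontr)
    assume "i \<noteq> m"
    have i: "i < r" "qn i < Qp" "i + 1 < r \<longrightarrow> Qp < qn (i + 1)"
      and m: "m < r" "qn m < Qp" "m + 1 < r \<longrightarrow> Qp < qn (m + 1)"
      using that Pm unfolding P_iff by auto
    have no: "\<not> a < b" if "b < r" "qn b < Qp" "a + 1 < r \<longrightarrow> Qp < qn (a + 1)" for a b
    proof
      assume "a < b"
      then have "Qp < qn (a + 1)" "\<not> qn b < qn (a + 1)"
        using that qn_less_iff[of b "a + 1"] by auto
      then show False
        using that by simp
    qed
    show False
      using no[OF m(1,2) i(3)] no[OF i(1,2) m(3)] \<open>i \<noteq> m\<close> by linarith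
  qed
  have "tt_m p q r = m"
    unfolding tt_m_def by (rule the_equality) (fact Pm, fact unique)
  then show "tt_m p q r < r" "qn (tt_m p q r) < Qp" "tt_m p q r + 1 < r \<Longrightarrow> Qp < qn (tt_m p q r + 1)"
    using Pm unfolding P_iff by auto
qed

text \<open>Passing from \<open>l\<close> to \<open>l + 1\<close> raises the quotient by 1 if the
  step wraps around \<open>p\<close>, that is, if \<open>l\<close> is in \<open>RN\<close>, and by 0
  otherwise.\<close>

lemma card_RN_below: "l \<le> p \<Longrightarrow> card {x \<in> RN. x < l} = l * q div p"
proof (induction l)
  case (Suc l)
  have mod: "l * q mod p < p"
    using p_pos by simp
  have "Suc l * q = (l * q mod p + q) + p * (l * q div p)"
    by (simp add: add.commute)
  then have div: "Suc l * q div p = l * q div p + (l * q mod p + q) div p"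
    using p_pos by (metis add.commute div_mult_self2 less_numeral_extra(3))
  show ?case
  proof (cases "l \<in> RN")
    case True
    then have "{x \<in> RN. x < Suc l} = insert l {x \<in> RN. x < l}"
      by auto
    then have "card {x \<in> RN. x < Suc l} = Suc (l * q div p)"
      using Suc finite_RN by simp
    moreover have "(l * q mod p + q) div p = 1"
      using True q_less add_less_le_mono[OF mod less_imp_le[OF q_less]]
      by (intro div_nat_eqI) (auto simp: RN_def simp del: mod_less_divisor)
    ultimately show ?thesis
      using div by simp
  next
    case False
    then have "{x \<in> RN. x < Suc l} = {x \<in> RN. x < l}"
      by (auto simp: less_Suc_eq)
    moreover have "(l * q mod p + q) div p = 0"
      using False Suc.prems by (intro div_less) (auto simp: RN_def)
    ultimately show ?thesis
      using div Suc by simp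
  qed
qed simp

lemma card_Rset_between:
  assumes "a \<le> b" "b \<le> p"
  shows "card {l \<in> tt_Rset p q. int a \<le> l \<and> l < int b} + a * q div p = b * q div p"
proof -
  have "{l \<in> tt_Rset p q. int a \<le> l \<and> l < int b} = int ` {l \<in> RN. a \<le> l \<and> l < b}"
    by (auto simp: tt_Rset_eq)
  then have "card {l \<in> tt_Rset p q. int a \<le> l \<and> l < int b} = card {l \<in> RN. a \<le> l \<and> l < b}"
    by (simp add: card_image)
  moreover have "card ({l \<in> RN. a \<le> l \<and> l < b} \<union> {l \<in> RN. l < a}) = card {l \<in> RN. a \<le> l \<and> l < b} + card {l \<in> RN. l < a}"
    using finite_RN by (intro card_Un_disjoint) auto
  moreover have "{l \<in> RN. a \<le> l \<and> l < b} \<union> {l \<in> RN. l < a} = {l \<in> RN. l < b}"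
    using assms by auto
  ultimately show ?thesis
    using assms by (simp add: card_RN_below)
qed

lemma qn_less_p: "i < r \<Longrightarrow> qn i < p"
  using qn_image by (auto simp: QN_def)

text \<open>The counts of wraps between consecutive elements of Q telescope, starting from the
  smallest element 0.\<close>

lemma tt_kbar_eq: "i < r \<Longrightarrow> tt_kbar p q r i = qn i * q div p"
proof (induction i)
  case (Suc i)
  have "qn i \<le> qn (Suc i)" "qn (Suc i) \<le> p"
    using Suc.prems qn_less_iff[of i "Suc i"] qn_less_p[of "Suc i"] by auto
  then have "tt_k p q r (Suc i) + qn i * q div p = qn (Suc i) * q div p"
    using Suc.prems card_Rset_between[of "qn i" "qn (Suc i)"] by (simp add: tt_k_def tt_Q_eq)
  then show ?case
    using Suc by (simp add: tt_kbar_def)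
qed (simp add: tt_kbar_def qn_0)

lemma tt_kbar'_eq: "tt_kbar' p q r = Qp * q div p"
  using card_Rset_between[of "qn (tt_m p q r)" Qp] qn_tt_m Qp(2) tt_m_less
  by (simp add: tt_kbar'_def tt_kbar_eq tt_k'_def tt_Q_eq tt_Q'_eq add.commute)

section \<open>Solving the equations along the orbit of translation by q\<close>

lemma mod_p_neq [simp]: "x mod p \<noteq> p"
  using mod_less_divisor[OF p_pos, of x] by simp

text \<open>Equals t^(hq) (a + t^(-j) b) with j = h q mod p, where a + t^(-j) b is the inhomogeneous
  term of equation j divided by 1 - t^(rs).\<close>

definition orb :: "laurent \<Rightarrow> laurent \<Rightarrow> nat \<Rightarrow> laurent" where
  "orb a b h = tpow (int (h * q)) * a + tpow (int (h * q div p * p)) * b"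

text \<open>The solution at time \<open>l\<close>, rescaled by t^(lq + cnt(l) rs). The rescaling
  removes the coefficients of the recursion, so that \<open>G\<close> changes only at the times in
  \<open>W\<close>.\<close>

definition G :: "laurent \<Rightarrow> laurent \<Rightarrow> nat \<Rightarrow> laurent" where
  "G a b l = a + b - (1 - tpow (int r * s)) * (\<Sum>h \<in> {h \<in> W. h < l}. tpow (int (cnt h) * (int r * s)) * orb a b h)"

text \<open>Solves every orbit equation except the one that closes the orbit. The parameters are
  chosen so that x_0 = a + b and x_p = b, which separates the sums for Y and X.\<close>

definition sol :: "laurent \<Rightarrow> laurent \<Rightarrow> nat \<Rightarrow> laurent" where
  "sol a b j = (if j = p then b else tpow (- int (lg j * q) - int (cnt (lg j)) * (int r * s)) * G a b (lg j))"

definition cf :: "nat \<Rightarrow> laurent" where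
  "cf j = (if j < r then tpow (int r * s + int q) else tpow (int q))"

lemma lunit_cf: "lunit (cf j)"
  by (simp add: cf_def)

lemma cnt_0: "cnt 0 = 0" and G_0: "G a b 0 = a + b"
  by (simp_all add: cnt_def G_def)

lemma sol_0: "sol a b 0 = a + b" and sol_p: "sol a b p = b"
  using p_pos by (simp_all add: sol_def lg_0 cnt_0 G_0)

lemma W_below_Suc: "{h \<in> W. h < Suc l} = (if l \<in> W then insert l {h \<in> W. h < l} else {h \<in> W. h < l})"
  by (auto simp: less_Suc_eq)

lemma cnt_Suc: "cnt (Suc l) = (if l \<in> W then Suc (cnt l) else cnt l)"
  using finite_W unfolding cnt_def W_below_Suc by simp

lemma G_Suc: "G a b (Suc l) = (if l \<in> W then G a b l - (1 - tpow (int r * s)) * (tpow (int (cnt l) * (int r * s)) * orb a b l) else G a b l)"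
  using finite_W unfolding G_def W_below_Suc by (simp add: algebra_simps)

lemma mem_W: "l \<in> W \<longleftrightarrow> l \<noteq> 0 \<and> l < p \<and> l * q mod p < r"
  by (auto simp: W_def QN_def)

lemma sol_orbit: "l < p \<Longrightarrow> sol a b (l * q mod p) = tpow (- int (l * q) - int (cnt l) * (int r * s)) * G a b l"
  using p_pos mod_less_divisor[OF p_pos, of "l * q"] by (simp add: sol_def mult_lg)

text \<open>The difference on the right vanishes unless \<open>l = p - 1\<close>, where the orbit closes up.\<close>

lemma krow_sol:
  assumes "l < p"
  shows "krow (l * q mod p) (sol a b) = cf (l * q mod p) *
    (sol a b ((l + 1) * q mod p) - tpow (- int ((l + 1) * q) - int (cnt (l + 1)) * (int r * s)) * G a b (l + 1))"
proof -
  define j where "j = l * q mod p"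
  have j: "j < p" "j \<noteq> p"
    using p_pos by (auto simp: j_def)
  have next_j: "(j + q) mod p = (l + 1) * q mod p"
    by (simp add: j_def mod_add_right_eq add.commute)
  have sol_j: "sol a b j = tpow (- int (l * q) - int (cnt l) * (int r * s)) * G a b l"
    unfolding j_def by (rule sol_orbit[OF assms])
  let ?\<phi> = "tpow (- int ((l + 1) * q) - int (cnt (l + 1)) * (int r * s)) * G a b (l + 1)"
  \<comment> \<open>\<open>?\<phi>\<close> is the value predicted by the recursion at time
    \<open>l + 1\<close>. Splitting off the prediction error leaves a remainder that vanishes by the
    recursion of \<open>G\<close>.\<close>
  have "krow j (sol a b) = cf j * (sol a b ((l + 1) * q mod p) - ?\<phi>)
    + (cf j * ?\<phi> - sol a b j + (if j < r then (1 - tpow (int r * s)) * (a + b + (tpow (- int j) - 1) * b) else 0))"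
    using j by (simp add: krow_def next_j cf_def sol_0 sol_p right_diff_distrib)
  moreover have "cf j * ?\<phi> - sol a b j + (if j < r then (1 - tpow (int r * s)) * (a + b + (tpow (- int j) - 1) * b) else 0) = 0"
  proof (cases "j < r")
    case False
    then have "l \<notin> W"
      by (simp add: mem_W j_def)
    then show ?thesis
      using False by (simp add: cf_def sol_j cnt_Suc G_Suc tpow_collect algebra_simps)
  next
    case True
    show ?thesis
    proof (cases "l = 0")
      case l: True
      then have "l \<notin> W" "j = 0"
        by (simp_all add: mem_W j_def)
      then show ?thesis
        using True l by (simp add: cf_def sol_0 cnt_0 cnt_Suc G_Suc G_0 tpow_collect algebra_simps)
    next
      case False
      then have lW: "l \<in> W"
        using True assms by (simp add: mem_W j_def)
      have lq: "- int (l * q) + int (l * q div p * p) = - int j"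
      proof -
        have "l * q = l * q div p * p + j"
          unfolding j_def by (simp add: div_mult_mod_eq)
        then have "int (l * q) = int (l * q div p * p) + int j"
          by (metis of_nat_add)
        then show ?thesis
          by simp
      qed
      have "cf j * ?\<phi> = tpow (- int (l * q) - int (cnt l) * (int r * s)) *
        (G a b l - (1 - tpow (int r * s)) * (tpow (int (cnt l) * (int r * s)) * orb a b l))"
        using True lW by (simp add: cf_def cnt_Suc G_Suc tpow_collect algebra_simps)
      also have "\<dots> = sol a b j - (1 - tpow (int r * s)) * (tpow (- int (l * q)) * orb a b l)"
      proof -
        have "tpow (- int (l * q) - int (cnt l) * (int r * s)) * (tpow (int (cnt l) * (int r * s)) * orb a b l) =
          tpow (- int (l * q)) * orb a b l"
          by (simp add: tpow_mult_left)
        then show ?thesis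
          unfolding sol_j right_diff_distrib mult.left_commute[of _ "1 - tpow (int r * s)"] by (simp only:)
      qed
      also have "tpow (- int (l * q)) * orb a b l = a + tpow (- int j) * b"
        unfolding orb_def distrib_left tpow_mult_left lq by simp
      finally show ?thesis
        using True by (simp add: algebra_simps)
    qed
  qed
  ultimately show ?thesis
    by (simp only: j_def[symmetric] add_0_right)
qed

text \<open>At time Q_i the two powers in \<open>orb\<close> have exponents Q_i q and p times the
  number of wraps, so the coefficients of \<open>a\<close> and \<open>b\<close> are the sums in Y
  and X.\<close>

lemma G_qn:
  assumes "k < r" "qn k < l" "k + 1 < r \<longrightarrow> l \<le> qn (k + 1)"
  shows "G a b l =
    a * (1 - (1 - tpow (int r * s)) * (\<Sum>i = 1..k. tpow (tt_Q p q r i * int q + (int i - 1) * int r * s))) +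
    b * (1 - (1 - tpow (int r * s)) * (\<Sum>i = 1..k. tpow (int (tt_kbar p q r i) * int p + (int i - 1) * int r * s)))"
proof -
  let ?A = "\<Sum>i = 1..k. tpow (tt_Q p q r i * int q + (int i - 1) * int r * s)"
  let ?B = "\<Sum>i = 1..k. tpow (int (tt_kbar p q r i) * int p + (int i - 1) * int r * s)"
  have "(\<Sum>h \<in> {h \<in> W. h < l}. tpow (int (cnt h) * (int r * s)) * orb a b h) =
    (\<Sum>i = 1..k. tpow (int (i - 1) * (int r * s)) * orb a b (qn i))"
    by (rule sum_W_below(1)[OF assms])
  also have "\<dots> = (\<Sum>i = 1..k. tpow (tt_Q p q r i * int q + (int i - 1) * int r * s) * a +
      tpow (int (tt_kbar p q r i) * int p + (int i - 1) * int r * s) * b)"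
    by (intro sum.cong refl) (use assms(1) in \<open>simp add: orb_def tt_Q_eq tt_kbar_eq of_nat_diff distrib_left tpow_mult_left mult.assoc add.commute\<close>)
  also have "\<dots> = ?A * a + ?B * b"
    by (simp add: sum.distrib sum_distrib_right)
  finally show ?thesis
    unfolding G_def by (simp add: algebra_simps)
qed

lemma cnt_p: "cnt p = r - 1"
  by (rule sum_W_below(2)) (use qn_last in auto)

lemma cnt_Qp: "cnt Qp = tt_m p q r"
  by (rule sum_W_below(2)) (use tt_m_less qn_tt_m Qp_less in auto)

lemma G_p: "G a b p = a * tt_Y p q r s + b * tt_X p q r s + tpow (int p * int q + (int r - 1) * int r * s) * (a + b)"
  using G_qn[of "r - 1" p a b] qn_last unfolding tt_Y_def tt_X_def by (simp add: algebra_simps)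

lemma G_Qp: "G a b Qp = a * tt_Ytilde p q r s + b * tt_Xtilde p q r s +
  tpow (int (Qp * q) + int (tt_m p q r) * (int r * s)) * (a + tpow (- int r) * b)"
proof -
  have "Qp * q = Qp * q div p * p + r"
    using div_mult_mod_eq[of "Qp * q" p] Qp(1) by simp
  then have "int (Qp * q) = int (Qp * q div p * p) + int r"
    by (metis of_nat_add)
  \<comment> \<open>At time Q' the orbit is at position r, so the two final exponents in
    \<open>tt_Xtilde\<close> and \<open>tt_Ytilde\<close> differ by r. The case \<open>m = 0\<close>
    needs no separate treatment below, since its sums are empty.\<close>
  then have e: "int (tt_kbar' p q r) * int p = int (Qp * q) - int r"
    by (simp add: tt_kbar'_eq)
  have X: "tt_Xtilde p q r s = 1 - (1 - tpow (int r * s)) *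
      (\<Sum>i = 1..tt_m p q r. tpow (int (tt_kbar p q r i) * int p + (int i - 1) * int r * s))
      - tpow (int (Qp * q) + int (tt_m p q r) * (int r * s)) * tpow (- int r)"
    unfolding tt_Xtilde_def e by (simp add: tpow_mult mult.assoc diff_add_eq)
  have Y: "tt_Ytilde p q r s = 1 - (1 - tpow (int r * s)) *
      (\<Sum>i = 1..tt_m p q r. tpow (tt_Q p q r i * int q + (int i - 1) * int r * s))
      - tpow (int (Qp * q) + int (tt_m p q r) * (int r * s))"
    unfolding tt_Ytilde_def tt_Q'_eq by (simp add: mult.assoc)
  have "G a b Qp =
    a * (1 - (1 - tpow (int r * s)) * (\<Sum>i = 1..tt_m p q r. tpow (tt_Q p q r i * int q + (int i - 1) * int r * s))) +
    b * (1 - (1 - tpow (int r * s)) * (\<Sum>i = 1..tt_m p q r. tpow (int (tt_kbar p q r i) * int p + (int i - 1) * int r * s)))"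
    using tt_m_less qn_tt_m Qp_less by (intro G_qn) auto
  moreover have "a * u + b * v = a * (u - w) + b * (v - w * z) + w * (a + z * b)" for u v w z
    by (simp add: algebra_simps)
  ultimately show ?thesis
    unfolding X Y by metis
qed

text \<open>At time p - 1 the orbit returns to 0, and the equation compares x_0 = a + b with the
  predicted value at time p. The last term of \<open>G_p\<close> cancels a + b.\<close>

lemma krow_sol_last:
  "\<exists>u. lunit u \<and> (\<forall>a b. krow ((p - 1) * q mod p) (sol a b) = u * (a * tt_Y p q r s + b * tt_X p q r s))"
proof -
  define T where "T = int p * int q + (int r - 1) * int r * s"
  have T: "- int (p * q) - int (cnt p) * (int r * s) = - T"
    using r_gt by (simp add: T_def cnt_p of_nat_diff mult.assoc)
  have "krow ((p - 1) * q mod p) (sol a b) =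
    cf ((p - 1) * q mod p) * (- tpow (- T)) * (a * tt_Y p q r s + b * tt_X p q r s)" for a b
  proof -
    have "krow ((p - 1) * q mod p) (sol a b) = cf ((p - 1) * q mod p) * (a + b - tpow (- T) * G a b p)"
      using krow_sol[of "p - 1" a b] p_pos T by (simp add: sol_0)
    also have "a + b - tpow (- T) * G a b p = - tpow (- T) * (a * tt_Y p q r s + b * tt_X p q r s)"
      unfolding G_p T_def[symmetric] by (simp add: distrib_left tpow_mult_left)
    finally show ?thesis
      by (simp only: mult.assoc)
  qed
  then show ?thesis
    by (intro exI[of _ "cf ((p - 1) * q mod p) * (- tpow (- T))"]) (simp add: lunit_cf lunit_mult)
qed

text \<open>The equation defining x_p involves x_r, which the orbit reaches at time
  \<open>Qp\<close>. The last term of \<open>G_Qp\<close> cancels the contributions of x_0 and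
  x_p.\<close>

lemma krow_sol_p:
  "\<exists>u. lunit u \<and> (\<forall>a b. krow p (sol a b) = u * (a * tt_Ytilde p q r s + b * tt_Xtilde p q r s))"
proof -
  define T where "T = int (Qp * q) + int (tt_m p q r) * (int r * s)"
  have "krow p (sol a b) = - (tpow (int r) * tpow (- T)) * (a * tt_Ytilde p q r s + b * tt_Xtilde p q r s)" for a b
  proof -
    have "sol a b r = tpow (- T) * G a b Qp"
      using sol_orbit[OF Qp(2), of a b] Qp(1) by (simp add: cnt_Qp T_def)
    also have "\<dots> = tpow (- T) * (a * tt_Ytilde p q r s + b * tt_Xtilde p q r s) + (a + tpow (- int r) * b)"
      unfolding G_Qp T_def[symmetric] by (simp add: distrib_left tpow_mult_left)
    finally show ?thesis
      by (simp add: krow_def sol_0 sol_p algebra_simps tpow_collect)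
  qed
  then show ?thesis
    by (intro exI[of _ "- (tpow (int r) * tpow (- T))"]) (simp add: lunit_mult)
qed

section \<open>Triangular elimination along the orbit, and comparison of determinants\<close>

lemma orbit_permutes: "(\<lambda>i. if i < p then (i + k) * q mod p else i) permutes {..<p + 1}" (is "?f permutes _")
proof (rule bij_imp_permutes)
  have less: "?f i < p" if "i < p" for i
    using that p_pos by simp
  have "inj_on ?f {..<p + 1}"
  proof (rule inj_onI)
    fix i j assume ij: "i \<in> {..<p + 1}" "j \<in> {..<p + 1}" "?f i = ?f j"
    show "i = j"
    proof (cases "i < p \<and> j < p")
      case True
      then have "(i + k) mod p = (j + k) mod p"
        using ij mult_lg[of "i + k"] mult_lg[of "j + k"] by simp
      then have "i mod p = j mod p"
        using cong_add_rcancel_nat[of i k j p] by (simp add: cong_def)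
      then show ?thesis
        using True by simp
    next
      case False
      then show ?thesis
        using ij less[of i] less[of j] by (auto split: if_splits)
    qed
  qed
  moreover have "?f ` {..<p + 1} \<subseteq> {..<p + 1}"
    using less by (auto intro: less_SucI)
  ultimately show "bij_betw ?f {..<p + 1} {..<p + 1}"
    unfolding bij_betw_def using endo_inj_surj[of "{..<p + 1}" ?f] by blast
qed auto

text \<open>Equations are ordered by time and unknowns by time plus one, which makes the part before
  closure triangular with unit diagonal. The two basic solutions satisfy those equations, leaving a
  2 by 2 determinant from the closing equation and the equation of x_p.\<close>

lemma fdet_krow_solve:
  assumes d: "\<And>\<rho> \<gamma> v. \<rho> permutes {..<p + 1} \<Longrightarrow> \<gamma> permutes {..<p + 1} \<Longrightarrow>
      assoc_l (fdet (p + 1) (\<lambda>i c. krow (\<rho> i) (v c))) (d * fdet (p + 1) (\<lambda>g c. v c (\<gamma> g)))"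
  shows "assoc_l d (tt_Xtilde p q r s * tt_Y p q r s - tt_X p q r s * tt_Ytilde p q r s)"
proof -
  define n where "n = p - 1"
  have n: "p + 1 = n + 2" "n + 1 = p" "n < p"
    using p_pos by (auto simp: n_def)
  define \<rho> where "\<rho> = (\<lambda>i. if i < p then (i + 0) * q mod p else i)"
  define \<gamma> where "\<gamma> = (\<lambda>i. if i < p then (i + 1) * q mod p else i)"
  have \<rho>: "\<rho> permutes {..<p + 1}" and \<gamma>: "\<gamma> permutes {..<p + 1}"
    unfolding \<rho>_def \<gamma>_def by (rule orbit_permutes)+
  have \<gamma>_inj: "\<gamma> i = \<gamma> j \<longleftrightarrow> i = j" for i j
    using permutes_inj[OF \<gamma>] by (auto dest: injD)
  \<comment> \<open>Unit vectors at the positions of times 1, ..., p - 1, then the two basic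
    solutions. On the remaining unknowns x_0 and x_p the latter form a matrix of determinant
    1.\<close>
  define v where "v = (\<lambda>c. if c < n then (\<lambda>j. if j = \<gamma> c then 1 else 0) else if c = n then sol 1 0 else sol 0 1)"
  have \<gamma>n: "\<gamma> n = 0" "\<gamma> (n + 1) = p"
    using n by (simp_all add: \<gamma>_def)
  have \<rho>n: "\<rho> n = (p - 1) * q mod p" "\<rho> (n + 1) = p"
    using n by (simp_all add: \<rho>_def n_def)
  have "fdet (n + 2) (\<lambda>g c. v c (\<gamma> g)) = fdet n (\<lambda>g c. v c (\<gamma> g)) * fdet 2 (\<lambda>g c. v (n + c) (\<gamma> (n + g)))"
    by (rule fdet_four_block') (simp add: v_def \<gamma>_inj)
  also have "fdet n (\<lambda>g c. v c (\<gamma> g)) = 1"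
    by (subst fdet_lower_triangular) (auto simp: v_def \<gamma>_inj)
  also have "fdet 2 (\<lambda>g c. v (n + c) (\<gamma> (n + g))) = 1"
    unfolding fdet_2 add_0_right \<gamma>n by (simp add: v_def sol_0 sol_p)
  finally have det_v: "fdet (p + 1) (\<lambda>g c. v c (\<gamma> g)) = 1"
    by (simp only: n(1) mult_1)
  have zero: "krow (\<rho> l) (sol a b) = 0" if "l < n" for l a b
  proof -
    have "l < p" "l + 1 < p"
      using that n by auto
    then show ?thesis
      using krow_sol[of l a b] sol_orbit[of "l + 1" a b] by (simp add: \<rho>_def)
  qed
  have low: "krow (\<rho> l) (v c) = (if c = l then cf (\<rho> l) else 0)" if "l \<le> c" "c < n" for l c
  proof -
    have lp: "l < p" "c < p" "Suc c < p"
      using that n by auto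
    have \<gamma>c: "\<gamma> c \<noteq> 0" "\<gamma> c \<noteq> p"
      using \<gamma>_inj[of c n] \<gamma>_inj[of c "n + 1"] \<gamma>n that by auto
    have \<gamma>l: "(\<rho> l + q) mod p = \<gamma> l"
      using lp by (simp add: \<rho>_def \<gamma>_def mod_add_right_eq add.commute)
    have "\<rho> l \<noteq> \<gamma> c"
    proof
      assume "\<rho> l = \<gamma> c"
      then have "lg (l * q mod p) = lg (Suc c * q mod p)"
        using lp by (simp add: \<rho>_def \<gamma>_def)
      then show False
        unfolding mult_lg using lp that by simp
    qed
    moreover have "\<rho> l \<noteq> p"
      using lp p_pos mod_less_divisor[OF p_pos, of "l * q"] by (simp add: \<rho>_def)
    ultimately show ?thesis
      unfolding krow_def \<gamma>l using that \<gamma>c by (auto simp: v_def \<gamma>_inj cf_def)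
  qed
  obtain u where u: "lunit u" "\<And>a b. krow (\<rho> n) (sol a b) = u * (a * tt_Y p q r s + b * tt_X p q r s)"
    using krow_sol_last unfolding \<rho>n by blast
  obtain u' where u': "lunit u'" "\<And>a b. krow (\<rho> (n + 1)) (sol a b) = u' * (a * tt_Ytilde p q r s + b * tt_Xtilde p q r s)"
    using krow_sol_p unfolding \<rho>n by blast
  have "fdet (n + 2) (\<lambda>i c. krow (\<rho> i) (v c)) =
    fdet n (\<lambda>i c. krow (\<rho> i) (v c)) * fdet 2 (\<lambda>i c. krow (\<rho> (n + i)) (v (n + c)))"
    by (rule fdet_four_block) (simp add: v_def zero)
  also have "fdet n (\<lambda>i c. krow (\<rho> i) (v c)) = (\<Prod>i<n. cf (\<rho> i))"
    by (subst fdet_lower_triangular) (auto simp: low)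
  also have "fdet 2 (\<lambda>i c. krow (\<rho> (n + i)) (v (n + c))) =
    u * u' * (tt_Xtilde p q r s * tt_Y p q r s - tt_X p q r s * tt_Ytilde p q r s)"
    unfolding fdet_2 by (simp add: v_def u(2) u'(2)[simplified] algebra_simps)
  finally have det: "fdet (p + 1) (\<lambda>i c. krow (\<rho> i) (v c)) =
    ((\<Prod>i<n. cf (\<rho> i)) * (u * u')) * (tt_Xtilde p q r s * tt_Y p q r s - tt_X p q r s * tt_Ytilde p q r s)"
    by (simp only: n(1) mult.assoc)
  have "assoc_l d (fdet (p + 1) (\<lambda>i c. krow (\<rho> i) (v c)))"
    using d[OF \<rho> \<gamma>, of v] unfolding det_v by (simp add: assoc_l_sym)
  also have "assoc_l (fdet (p + 1) (\<lambda>i c. krow (\<rho> i) (v c)))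
    (tt_Xtilde p q r s * tt_Y p q r s - tt_X p q r s * tt_Ytilde p q r s)"
    unfolding det using u(1) u'(1) by (intro assoc_l_unit lunit_mult lunit_prod lunit_cf)
  finally show ?thesis .
qed

text \<open>The same coefficient determinant \<open>d\<close> is evaluated by both families of test
  vectors; this replaces the reduced Burau determinant, times (1 - t^q) (1 - t^r), by the orbit
  expression.\<close>

lemma alexander_polynomial:
  obtains C where "\<And>D. is_closure_alexander_polynomial p (twisted_torus_braid p q r s) D \<longleftrightarrow> assoc_l D C"
    "assoc_l ((1 - tpow (int p)) * (1 - tpow (int q)) * (1 - tpow (int r)) * C)
      ((1 - tpow 1) * (tt_Xtilde p q r s * tt_Y p q r s - tt_X p q r s * tt_Ytilde p q r s))"
proof -
  have p: "p = Suc (p - 1)"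
    using p_pos by simp
  obtain C where C: "\<And>D. is_closure_alexander_polynomial p (twisted_torus_braid p q r s) D \<longleftrightarrow> assoc_l D C"
    and C': "assoc_l ((1 - tpow (int p)) * C) ((1 - tpow 1) * fdet (p - 1)
      (\<lambda>i c. psum (fold burau (twisted_torus_braid p q r s) (bump c)) (i + 1) - psum (bump c) (i + 1)))"
    using closure_alexander_polynomial[OF valid_twisted_torus_braid p] by blast
  obtain d where d: "\<And>\<rho> \<gamma> v. \<rho> permutes {..<p + 1} \<Longrightarrow> \<gamma> permutes {..<p + 1} \<Longrightarrow>
      assoc_l (fdet (p + 1) (\<lambda>i c. krow (\<rho> i) (v c))) (d * fdet (p + 1) (\<lambda>g c. v c (\<gamma> g)))"
    using fdet_functionals[of "p + 1" krow] linear_below_krow by blast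
  let ?E = "(1 - tpow (int q)) * (1 - tpow (int r))"
  have "assoc_l ((1 - tpow (int p)) * C) ((1 - tpow 1) * fdet (p - 1) H)"
    using C' assoc_l_mult_left[OF fdet_twisted_torus, of "1 - tpow 1"] assoc_l_trans by blast
  then have "assoc_l (?E * ((1 - tpow (int p)) * C)) (?E * ((1 - tpow 1) * fdet (p - 1) H))"
    by (rule assoc_l_mult_left)
  then have "assoc_l ((1 - tpow (int p)) * (1 - tpow (int q)) * (1 - tpow (int r)) * C) ((1 - tpow 1) * (?E * fdet (p - 1) H))"
    by (simp only: mult_ac)
  also have "assoc_l ((1 - tpow 1) * (?E * fdet (p - 1) H))
    ((1 - tpow 1) * (tt_Xtilde p q r s * tt_Y p q r s - tt_X p q r s * tt_Ytilde p q r s))"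
    using assoc_l_sym[OF fdet_krow_eliminate[OF d]] fdet_krow_solve[OF d]
    by (intro assoc_l_mult_left) (rule assoc_l_trans)
  finally show thesis
    using that C by blast
qed

end

theorem theorem1:
  fixes p q r :: nat and s :: int
  assumes "coprime p q" and "0 < q" and "q < p" and "1 < r" and "r < p"
  shows "(\<exists>D. is_closure_alexander_polynomial p (twisted_torus_braid p q r s) D) \<and>
    (\<forall>D. is_closure_alexander_polynomial p (twisted_torus_braid p q r s) D \<longrightarrow>
      (\<exists>e \<in> {1, -1}. \<exists>n.
        (1 - tpow (int p)) * (1 - tpow (int q)) * (1 - tpow (int r)) * D =
        e * tpow n * (1 - tpow 1) * (tt_Xtilde p q r s * tt_Y p q r s - tt_X p q r s * tt_Ytilde p q r s)))"
proof -
  interpret twisted_torus p q r s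
    by unfold_locales (fact assms)+
  let ?E = "(1 - tpow (int p)) * (1 - tpow (int q)) * (1 - tpow (int r))"
  let ?F = "tt_Xtilde p q r s * tt_Y p q r s - tt_X p q r s * tt_Ytilde p q r s"
  obtain C where C: "\<And>D. is_closure_alexander_polynomial p (twisted_torus_braid p q r s) D \<longleftrightarrow> assoc_l D C"
    and F: "assoc_l (?E * C) ((1 - tpow 1) * ?F)"
    using alexander_polynomial by blast
  have "\<exists>e \<in> {1, -1}. \<exists>n. ?E * D = e * tpow n * (1 - tpow 1) * ?F"
    if "is_closure_alexander_polynomial p (twisted_torus_braid p q r s) D" for D
  proof -
    have "assoc_l (?E * D) (?E * C)"
      using that C by (intro assoc_l_mult_left) simp
    then have "assoc_l (?E * D) ((1 - tpow 1) * ?F)"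
      using F by (rule assoc_l_trans)
    then obtain e n where "e \<in> {1, -1}" "?E * D = e * tpow n * ((1 - tpow 1) * ?F)"
      unfolding assoc_l_def lunit_def by blast
    then have "?E * D = e * tpow n * (1 - tpow 1) * ?F"
      by (simp only: mult.assoc)
    with \<open>e \<in> {1, -1}\<close> show ?thesis
      by blast
  qed
  \<comment> \<open>Existence: the cofactor \<open>C\<close> is associated to itself.\<close>
  moreover have "is_closure_alexander_polynomial p (twisted_torus_braid p q r s) C"
    using C by simp
  ultimately show ?thesis
    by blast
qed

end
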